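(* Let $n > 1$ be an integer. Suppose $f \colon [0,\infty) \to \mathbb{R}$ has the $(n/2-1)$-SILP property, with $f(0)=1$ and $f(x) \le 0$ for all $x \ge 1$. Then the center density of every $n$-dimensional lattice packing is bounded above by $$ \frac{\Gamma(n/2)}{2^n \pi^{n/2} \int_0^\infty f(x)\, x^{n/2-1} \, dx}. $$
   Context: For $\alpha > -1$ and an integer $k \ge 0$, $L_k^\alpha$ denotes the (generalized) Laguerre polynomial of degree $k$ and parameter $\alpha$, with standard normalization, i.e. $\sum_{k\ge 0} L_k^\alpha(x) t^k = (1-t)^{-\alpha-1} e^{-xt/(1-t)}$; these are orthogonal on $[0,\infty)$ with respect to $x^\alpha e^{-x}\,dx$, and $\int_0^\infty L_j^\alpha(x)^2 x^\alpha e^{-x}\,dx = \Gamma(j+\alpha+1)/j!$. A function $f \colon [0,\infty) \to \mathbb{R}$ has the $\alpha$-SILP property ("scale-invariant Laguerre positivity") if: (1) $f$ is continuous and for some $\varepsilon > 0$ and $C > 0$ we have $|f(x)| \le C(1+|x|)^{-\alpha-1-\varepsilon}$ for all $x$; and (2) for every $y > 0$, the Laguerre series $\sum_{j \ge 0} a_j(y) L_j^\alpha(x)$ of the function $x \mapsto f(x/y)$ has $a_j(y) \ge 0$ for all $j$, where $$ a_j(y) = \frac{\int_0^\infty f(x/y) L_j^\alpha(x) x^\alpha e^{-x}\,dx}{\Gamma(j+\alpha+1)/j!}. $$ No convergence of the Laguerre series is assumed. A lattice packing in $\mathbb{R}^n$ is given by a full-rank lattice $\Lambda \subset \mathbb{R}^n$,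 with balls of radius $\ell/2$ centered at the lattice points, where $\ell$ is the length of the shortest non-zero vectors of $\Lambda$. Its center density is $(\ell/2)^n / \mathrm{vol}(\mathbb{R}^n/\Lambda)$ (the packing density divided by the volume of the unit ball). If the integral in the bound is $0$, the bound is interpreted as $+\infty$ (no constraint). *)

theory Defs
  imports "HOL-Analysis.Analysis"
begin

unbundle no vec_syntax
unbundle fps_syntax

text \<open>The generating function \<open>(1 - t) powr (- \<alpha> - 1) * exp (- x * t / (1 - t))\<close>, read as a formal
  power series in \<open>t\<close>; \<open>fps_binomial c\<close> is the binomial series \<open>(1 + t) powr c\<close>.\<close>

definition laguerre :: "real \<Rightarrow> nat \<Rightarrow> real \<Rightarrow> real" where
  "laguerre \<alpha> k x =
     ((fps_binomial (- \<alpha> - 1) oo (- fps_X)) * (fps_exp (- x) oo (fps_X / (1 - fps_X)))) $ k"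

lemma laguerre_explicit:
  "laguerre \<alpha> k x = (\<Sum>i\<le>k. (- 1) ^ i * ((real k + \<alpha>) gchoose (k - i)) * x ^ i / fact i)"
proof -
  let ?X = "fps_X :: real fps"
  let ?F = "fps_binomial (- \<alpha> - 1) oo (- ?X)"
  let ?g = "?X / (1 - ?X)"
  have g: "?g = ?X * inverse (1 - ?X)"
    by (simp add: fps_divide_unit)
  have inv: "inverse (1 - ?X) = fps_binomial (- 1) oo (- ?X)"
    by (simp add: fps_binomial_minus_one fps_inverse_compose fps_compose_add_distrib)
  have pw: "?F * ?g ^ i = ?X ^ i * (fps_binomial (- \<alpha> - 1 - real i) oo (- ?X))" for i
  proof -
    have "fps_binomial (- \<alpha> - 1 - real i) = fps_binomial (- \<alpha> - 1) * fps_binomial (- 1) ^ i"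
      by (simp add: fps_binomial_power fps_binomial_add_mult [symmetric] algebra_simps)
    then show ?thesis
      by (simp add: g inv power_mult_distrib fps_compose_mult_distrib fps_compose_power mult_ac)
  qed
  have neg: "(h oo (- ?X)) $ m = (- 1) ^ m * h $ m" for h m
    by (simp add: fps_compose_uminus')
  have cf: "(?F * ?g ^ i) $ k = (if i \<le> k then (real k + \<alpha>) gchoose (k - i) else 0)" for i
  proof (cases "i \<le> k")
    case True
    have "(- 1) ^ (k - i) * ((- \<alpha> - 1 - real i) gchoose (k - i)) = (real k + \<alpha>) gchoose (k - i)"
      using True by (subst (2) gbinomial_negated_upper) (simp add: of_nat_diff algebra_simps)
    then show ?thesis
      using True by (simp add: pw neg fps_X_power_mult_nth)
  qed (simp add: pw fps_X_power_mult_nth)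
  have g0: "?g $ 0 = 0"
    by (simp add: g)
  have "laguerre \<alpha> k x = (\<Sum>m=0..k. ?F $ m * (\<Sum>i=0..k - m. fps_exp (- x) $ i * (?g ^ i) $ (k - m)))"
    by (simp add: laguerre_def fps_mult_nth fps_compose_nth)
  also have "\<dots> = (\<Sum>m=0..k. \<Sum>i=0..k. fps_exp (- x) $ i * (?F $ m * (?g ^ i) $ (k - m)))"
  proof (rule sum.cong [OF refl])
    fix m assume "m \<in> {0..k}"
    have "(\<Sum>i=0..k - m. fps_exp (- x) $ i * (?g ^ i) $ (k - m)) =
          (\<Sum>i=0..k. fps_exp (- x) $ i * (?g ^ i) $ (k - m))"
      by (rule sum.mono_neutral_left) (use startsby_zero_power_prefix [OF g0] in auto)
    then show "?F $ m * (\<Sum>i=0..k - m. fps_exp (- x) $ i * (?g ^ i) $ (k - m)) =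
               (\<Sum>i=0..k. fps_exp (- x) $ i * (?F $ m * (?g ^ i) $ (k - m)))"
      by (simp add: sum_distrib_left mult_ac)
  qed
  also have "\<dots> = (\<Sum>i=0..k. fps_exp (- x) $ i * (?F * ?g ^ i) $ k)"
    by (subst sum.swap) (simp add: fps_mult_nth sum_distrib_left)
  also have "\<dots> = (\<Sum>i\<le>k. (- 1) ^ i * ((real k + \<alpha>) gchoose (k - i)) * x ^ i / fact i)"
    by (rule sum.cong) (auto simp: cf power_minus [of x])
  finally show ?thesis .
qed

unbundle no fps_syntax
unbundle vec_syntax

definition laguerre_coeff :: "real \<Rightarrow> (real \<Rightarrow> real) \<Rightarrow> nat \<Rightarrow> real" where
  "laguerre_coeff \<alpha> g j =
     (LINT x:{0..}|lborel. g x * laguerre \<alpha> j x * x powr \<alpha> * exp (- x)) /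
     (Gamma (real j + \<alpha> + 1) / fact j)"

text \<open>A function on \<open>[0, \<infinity>)\<close> is represented by a function on the reals whose values at negative
  arguments are never used.\<close>

definition SILP :: "real \<Rightarrow> (real \<Rightarrow> real) \<Rightarrow> bool" where
  "SILP \<alpha> f \<longleftrightarrow>
     continuous_on {0..} f \<and>
     (\<exists>\<epsilon>>0. \<exists>C>0. \<forall>x\<ge>0. \<bar>f x\<bar> \<le> C * (1 + \<bar>x\<bar>) powr (- \<alpha> - 1 - \<epsilon>)) \<and>
     (\<forall>y>0. \<forall>j. laguerre_coeff \<alpha> (\<lambda>x. f (x / y)) j \<ge> 0)"

definition lattice_basis :: "('n \<Rightarrow> real^'n) \<Rightarrow> (real^'n) set \<Rightarrow> bool" where
  "lattice_basis b \<Lambda> \<longleftrightarrow>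
     inj b \<and> independent (range b) \<and>
     \<Lambda> = {\<Sum>i\<in>UNIV. of_int (c i) *\<^sub>R b i |c :: 'n \<Rightarrow> int. True}"

definition full_rank_lattice :: "(real^'n) set \<Rightarrow> bool" where
  "full_rank_lattice \<Lambda> \<longleftrightarrow> (\<exists>b. lattice_basis b \<Lambda>)"

definition fundamental_parallelotope :: "('n \<Rightarrow> real^'n) \<Rightarrow> (real^'n) set" where
  "fundamental_parallelotope b =
     {\<Sum>i\<in>UNIV. t i *\<^sub>R b i |t :: 'n \<Rightarrow> real. \<forall>i. 0 \<le> t i \<and> t i < 1}"

text \<open>The volume of the quotient of the space by \<open>\<Lambda>\<close>. It does not depend on the chosen basis, by
  \<open>covolume_eq\<close> below.\<close>

definition covolume :: "(real^'n) set \<Rightarrow> real" where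
  "covolume \<Lambda> = measure lebesgue (fundamental_parallelotope (SOME b. lattice_basis b \<Lambda>))"

text \<open>For a lattice the infimum is attained.\<close>

definition min_length :: "(real^'n) set \<Rightarrow> real" where
  "min_length \<Lambda> = (INF v\<in>\<Lambda> - {0}. norm v)"

definition center_density :: "(real^'n) set \<Rightarrow> real" where
  "center_density \<Lambda> = (min_length \<Lambda> / 2) ^ CARD('n) / covolume \<Lambda>"


lemma lattice_basis_coordinates:
  fixes b :: "'n::finite \<Rightarrow> real^'n"
  assumes "lattice_basis b \<Lambda>"
  obtains M :: "real^'n^'n"
  where "\<And>x. (\<Sum>i\<in>UNIV. (M *v x) $ i *\<^sub>R b i) = x"
    and "\<And>t i. (M *v (\<Sum>j\<in>UNIV. t j *\<^sub>R b j)) $ i = t i"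
proof -
  let ?A = "(\<chi> i j. b j $ i) :: real^'n^'n"
  have A: "(\<Sum>i\<in>UNIV. t i *\<^sub>R b i) = ?A *v (\<chi> i. t i)" for t
    by (simp add: vec_eq_iff matrix_vector_mult_def mult.commute)
  have inj: "inj b" and ind: "independent (range b)"
    using assms by (auto simp: lattice_basis_def)
  have zero: "a i = 0" if "(\<Sum>i\<in>UNIV. a i *s column i ?A) = 0" for a i
  proof -
    have "column i ?A = b i" for i
      by (simp add: column_def vec_eq_iff)
    then have "(\<Sum>i\<in>UNIV. a i *\<^sub>R b i) = 0"
      using that by (simp add: scalar_mult_eq_scaleR)
    then have "(\<Sum>v\<in>range b. a (inv b v) *\<^sub>R v) = 0"
      using inj by (simp add: sum.reindex)
    then have "a (inv b (b i)) = 0"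
      using independentD [OF ind, of "range b" "\<lambda>v. a (inv b v)" "b i"] by simp
    then show ?thesis
      using inj by simp
  qed
  have "\<exists>M. M ** ?A = mat 1"
    by (rule iffD2 [OF matrix_left_invertible_independent_columns]) (intro allI impI zero)
  then obtain M where M: "M ** ?A = mat 1"
    by (elim exE)
  then have M': "?A ** M = mat 1"
    by (simp add: matrix_left_right_inverse)
  show thesis
    by (rule that [of M]) (simp_all add: A matrix_vector_mul_assoc M M')
qed

lemma fundamental_parallelotope_borel:
  fixes b :: "'n::finite \<Rightarrow> real^'n"
  assumes "lattice_basis b \<Lambda>"
  shows "fundamental_parallelotope b \<in> sets borel"
proof -
  obtain M where M: "\<And>x. (\<Sum>i\<in>UNIV. (M *v x) $ i *\<^sub>R b i) = x"
    "\<And>t i. (M *v (\<Sum>j\<in>UNIV. t j *\<^sub>R b j)) $ i = t i"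
    using lattice_basis_coordinates [OF assms] by blast
  have eq: "fundamental_parallelotope b = {x. \<forall>i. 0 \<le> (M *v x) $ i \<and> (M *v x) $ i < 1}"
  proof (rule set_eqI)
    fix x
    show "x \<in> fundamental_parallelotope b \<longleftrightarrow> x \<in> {x. \<forall>i. 0 \<le> (M *v x) $ i \<and> (M *v x) $ i < 1}"
      unfolding fundamental_parallelotope_def
      using M(1) [of x] M(2) by (auto intro!: exI [of _ "\<lambda>i. (M *v x) $ i"])
  qed
  have [measurable]: "(\<lambda>x. (M *v x) $ i) \<in> borel_measurable borel" for i
    by (intro borel_measurable_continuous_onI continuous_intros
        linear_continuous_on matrix_vector_mul_bounded_linear)
  show ?thesis
    unfolding eq by measurable
qed

lemma fundamental_parallelotope_tiles:
  fixes b :: "'n::finite \<Rightarrow> real^'n"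
  assumes "lattice_basis b \<Lambda>"
  shows "\<exists>!l. l \<in> \<Lambda> \<and> x \<in> (+) l ` fundamental_parallelotope b"
proof -
  obtain M where M: "\<And>x. (\<Sum>i\<in>UNIV. (M *v x) $ i *\<^sub>R b i) = x"
    "\<And>t i. (M *v (\<Sum>j\<in>UNIV. t j *\<^sub>R b j)) $ i = t i"
    using lattice_basis_coordinates [OF assms] by blast
  have L: "\<Lambda> = {\<Sum>i\<in>UNIV. of_int (c i) *\<^sub>R b i |c. True}"
    using assms by (simp add: lattice_basis_def)
  let ?l = "\<Sum>i\<in>UNIV. of_int \<lfloor>(M *v x) $ i\<rfloor> *\<^sub>R b i"
  show ?thesis
  proof (rule ex1I [of _ ?l], rule conjI)
    show "?l \<in> \<Lambda>"
      unfolding L by (intro CollectI exI [of _ "\<lambda>i. \<lfloor>(M *v x) $ i\<rfloor>"]) simp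
    have "x = ?l + (\<Sum>i\<in>UNIV. frac ((M *v x) $ i) *\<^sub>R b i)"
      by (simp add: M(1) frac_def flip: sum.distrib scaleR_add_left)
    moreover have "(\<Sum>i\<in>UNIV. frac ((M *v x) $ i) *\<^sub>R b i) \<in> fundamental_parallelotope b"
      unfolding fundamental_parallelotope_def
      by (auto simp: frac_lt_1 intro!: exI [of _ "\<lambda>i. frac ((M *v x) $ i)"])
    ultimately show "x \<in> (+) ?l ` fundamental_parallelotope b"
      by blast
  next
    fix l assume l: "l \<in> \<Lambda> \<and> x \<in> (+) l ` fundamental_parallelotope b"
    then obtain c t where c: "l = (\<Sum>i\<in>UNIV. of_int (c i) *\<^sub>R b i)"
      and t: "\<And>i. 0 \<le> t i \<and> t i < 1" and x: "x = l + (\<Sum>i\<in>UNIV. t i *\<^sub>R b i)"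
      unfolding L fundamental_parallelotope_def by auto
    have "(M *v x) $ i = of_int (c i) + t i" for i
      using M(2) [of "\<lambda>i. of_int (c i) + t i" i] by (simp add: x c sum.distrib scaleR_add_left)
    then have "\<lfloor>(M *v x) $ i\<rfloor> = c i" for i
      using t [of i] by (simp add: floor_unique)
    then show "l = ?l"
      by (simp add: c)
  qed
qed

lemma lattice_countable:
  fixes b :: "'n::finite \<Rightarrow> real^'n"
  assumes "lattice_basis b \<Lambda>"
  shows "countable \<Lambda>"
proof -
  have "\<Lambda> = (\<lambda>c. \<Sum>i\<in>UNIV. of_int (c i) *\<^sub>R b i) ` (UNIV :: ('n \<Rightarrow> int) set)"
    using assms unfolding lattice_basis_def by (simp only: full_SetCompr_eq simp_thms)
  moreover have "countable (UNIV :: ('n \<Rightarrow> int) set)"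
    using countable_PiE [of "UNIV :: 'n set" "\<lambda>_. UNIV :: int set"] by simp
  ultimately show ?thesis
    by (simp only: countable_image)
qed

lemma lattice_uminus:
  fixes b :: "'n::finite \<Rightarrow> real^'n"
  assumes "lattice_basis b \<Lambda>"
  shows "bij_betw uminus \<Lambda> \<Lambda>"
proof -
  have L: "\<Lambda> = {\<Sum>i\<in>UNIV. of_int (c i) *\<^sub>R b i |c. True}"
    using assms by (simp add: lattice_basis_def)
  have neg: "- l \<in> \<Lambda>" if l: "l \<in> \<Lambda>" for l
  proof -
    obtain c :: "'n \<Rightarrow> int" where "l = (\<Sum>i\<in>UNIV. of_int (c i) *\<^sub>R b i)"
      using l unfolding L by auto
    then have "- l = (\<Sum>i\<in>UNIV. of_int (- c i) *\<^sub>R b i)"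
      by (simp add: sum_negf)
    then show ?thesis
      unfolding L by (intro CollectI exI [of _ "\<lambda>i. - c i"]) simp
  qed
  show ?thesis
    by (rule bij_betw_byWitness [where f' = uminus]) (auto simp: neg)
qed

lemma covolume_eq:
  fixes b :: "'n::finite \<Rightarrow> real^'n"
  assumes b: "lattice_basis b \<Lambda>"
  shows "covolume \<Lambda> = measure lebesgue (fundamental_parallelotope b)"
proof -
  define b' where "b' = (SOME b. lattice_basis b \<Lambda>)"
  have b': "lattice_basis b' \<Lambda>"
    unfolding b'_def using someI [of "\<lambda>b. lattice_basis b \<Lambda>", OF b] .
  let ?P = "fundamental_parallelotope b" and ?Q = "fundamental_parallelotope b'"
  have meas: "(+) l ` S \<in> sets lebesgue" if "S \<in> sets borel" for l and S :: "(real^'n) set"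
    using that by (intro lebesgue_sets_translation) simp
  have split: "emeasure lebesgue S =
      (\<integral>\<^sup>+l. emeasure lebesgue (S \<inter> (+) l ` fundamental_parallelotope c) \<partial>count_space \<Lambda>)"
    if S: "S \<in> sets borel" and c: "lattice_basis c \<Lambda>" for S :: "(real^'n) set" and c
  proof -
    let ?X = "\<lambda>l. S \<inter> (+) l ` fundamental_parallelotope c"
    note tiles = fundamental_parallelotope_tiles [OF c]
    have "(\<Union>l\<in>\<Lambda>. ?X l) = S"
    proof (rule equalityI; rule subsetI)
      fix x assume "x \<in> S"
      moreover obtain l where "l \<in> \<Lambda>" "x \<in> (+) l ` fundamental_parallelotope c"
        using tiles [of x] by (elim ex1E conjE)
      ultimately show "x \<in> (\<Union>l\<in>\<Lambda>. ?X l)"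
        by (intro UN_I IntI)
    qed auto
    moreover have "disjoint_family_on ?X \<Lambda>"
      unfolding disjoint_family_on_def
    proof (intro ballI impI equals0I)
      fix l m x assume "l \<in> \<Lambda>" "m \<in> \<Lambda>" "l \<noteq> m" and x: "x \<in> ?X l \<inter> ?X m"
      moreover obtain k where "\<And>j. j \<in> \<Lambda> \<Longrightarrow> x \<in> (+) j ` fundamental_parallelotope c \<Longrightarrow> j = k"
        using tiles [of x] by (elim ex1E) blast
      ultimately show False
        by (metis IntD1 IntD2)
    qed
    moreover have "?X l \<in> sets lebesgue" for l
      using S meas [OF fundamental_parallelotope_borel [OF c], of l] by (intro sets.Int) simp_all
    ultimately show ?thesis
      using emeasure_UN_countable [of \<Lambda> ?X lebesgue] lattice_countable [OF c] by simp
  qed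
  have shift: "emeasure lebesgue (?P \<inter> (+) (- l) ` ?Q) = emeasure lebesgue (?Q \<inter> (+) l ` ?P)" for l
  proof -
    have "?Q \<inter> (+) l ` ?P = (+) l ` (?P \<inter> (+) (- l) ` ?Q)"
      by (force simp: image_iff)
    then show ?thesis
      using emeasure_lebesgue_affine [of 1 l "?P \<inter> (+) (- l) ` ?Q"]
      by (simp add: add.commute [of _ l] cong: image_cong_simp)
  qed
  have "emeasure lebesgue ?P = (\<integral>\<^sup>+l. emeasure lebesgue (?P \<inter> (+) l ` ?Q) \<partial>count_space \<Lambda>)"
    by (rule split [OF fundamental_parallelotope_borel [OF b] b'])
  also have "\<dots> = (\<integral>\<^sup>+l. emeasure lebesgue (?P \<inter> (+) (- l) ` ?Q) \<partial>count_space \<Lambda>)"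
    by (rule nn_integral_bij_count_space [OF lattice_uminus [OF b], symmetric])
  also have "\<dots> = (\<integral>\<^sup>+l. emeasure lebesgue (?Q \<inter> (+) l ` ?P) \<partial>count_space \<Lambda>)"
    by (simp only: shift)
  also have "\<dots> = emeasure lebesgue ?Q"
    by (rule split [OF fundamental_parallelotope_borel [OF b'] b, symmetric])
  finally show ?thesis
    by (simp add: covolume_def b'_def measure_def)
qed

end

theory Submission
  imports Defs "HOL-Probability.Probability" "HOL-Real_Asymp.Real_Asymp"
begin

text \<open>The function \<open>x \<mapsto> f (|x|\<^sup>2)\<close> on \<open>\<real>\<^sup>n\<close> has a nonnegative Fourier transform: the Laguerre functions
  \<open>L\<^sub>j (|x|\<^sup>2 / 4w) exp (- |x|\<^sup>2 / 4w)\<close> are, up to positive factors, the transforms of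
  \<open>|\<xi>|\<^bsup>2j\<^esup> exp (- w |\<xi>|\<^sup>2)\<close>, so the SILP property says that the (radial) transform has nonnegative
  integrals against all these weights, and the weights concentrate on any given sphere.
  The linear programming bound then follows without Poisson summation. Rescale so that the lattice
  has minimal length \<open>1\<close> and choose coordinates in which it is \<open>\<int>\<^sup>n\<close>. Multiplying by a Fejer kernel,
  whose Fourier coefficients are nonnegative with constant term \<open>1\<close>, can only increase the integral;
  but the kernel concentrates on the lattice, and the function is nonpositive outside a bounded
  neighbourhood of the origin and at all nonzero lattice points, so the integral is at most the value
  at the origin.\<close>


text \<open>SILP controls the size of f but not that of the transform, which is only known to be
  continuous, bounded and nonnegative; that is too little for Poisson summation. On the other side,
  nonpositivity far out means that only an upper bound on one fixed box is needed, and no sum over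
  the lattice occurs. Passing from Laguerre coefficients to the transform involves no Laguerre
  series either: each coefficient is a single integral, and Fubini moves the transform onto the
  explicit Gaussian weight. Under the normalised weight |\<xi>|^(2 j) exp (- w |\<xi>|^2) the
  variable |\<xi>|^2 is Gamma distributed with mean (n/2 + j) / w and variance (n/2 + j) / w^2, so j
  near t w with w growing concentrates it at t.\<close>

section \<open>Product integrals and the Fourier transform of a Gaussian\<close>

lemma
  fixes h :: "'a::euclidean_space \<Rightarrow> real \<Rightarrow> 'b::{real_normed_field,banach,second_countable_topology}"
  assumes "\<And>b. b \<in> Basis \<Longrightarrow> integrable lborel (h b)"
  shows integrable_lborel_prod: "integrable lborel (\<lambda>x. \<Prod>b\<in>Basis. h b (x \<bullet> b))"
    and integral_lborel_prod:
      "(\<integral>x. (\<Prod>b\<in>Basis. h b (x \<bullet> b)) \<partial>lborel) = (\<Prod>b\<in>Basis. \<integral>t. h b t \<partial>lborel)"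
proof -
  interpret product_sigma_finite "\<lambda>_::'a. lborel :: real measure" ..
  have [measurable]: "h b \<in> borel_measurable borel" if "b \<in> Basis" for b
    using borel_measurable_integrable [OF assms [OF that]] by simp
  have *: "(\<Prod>b\<in>Basis. h b ((\<Sum>c\<in>Basis. y c *\<^sub>R c) \<bullet> b)) = (\<Prod>b\<in>Basis. h b (y b))" for y
    by (rule prod.cong) simp_all
  have [measurable]: "(\<lambda>x. \<Prod>b\<in>Basis. h b (x \<bullet> b)) \<in> borel_measurable borel"
    by measurable
  show "integrable lborel (\<lambda>x. \<Prod>b\<in>Basis. h b (x \<bullet> b))"
    by (subst lborel_eq, subst integrable_distr_eq) (simp_all add: * assms product_integrable_prod)
  show "(\<integral>x. (\<Prod>b\<in>Basis. h b (x \<bullet> b)) \<partial>lborel) = (\<Prod>b\<in>Basis. \<integral>t. h b t \<partial>lborel)"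
    by (subst lborel_eq, subst integral_distr) (simp_all add: * assms product_integral_prod)
qed

text \<open>The substitution with factor sqrt (2 w) turns the Gaussian into the standard normal
  density and the integral into its characteristic function at x / sqrt (2 w).\<close>

lemma gaussian_fourier_1d:
  fixes w x :: real
  assumes "w > 0"
  shows "integrable lborel (\<lambda>t. of_real (exp (- (w * t\<^sup>2))) * cis (t * x))"
    and "(\<integral>t. of_real (exp (- (w * t\<^sup>2))) * cis (t * x) \<partial>lborel) =
      of_real (sqrt (pi / w) * exp (- (x\<^sup>2 / (4 * w))))"
proof -
  define c where "c = sqrt (2 * w)"
  have c: "c > 0" "c\<^sup>2 = 2 * w"
    using assms by (auto simp: c_def)
  let ?s = "x / c"
  let ?g = "\<lambda>t. of_real (std_normal_density t) * iexp (?s * t) :: complex"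
  have cs: "c * (t * x) / c = t * x" for t using c by simp
  have g: "?g (0 + c * t) = of_real (1 / sqrt (2 * pi)) * (of_real (exp (- (w * t\<^sup>2))) * cis (t * x))" for t
    using c by (simp add: std_normal_density_def cis_conv_exp power_mult_distrib mult_ac)
  have int: "integrable lborel ?g"
  proof (rule Bochner_Integration.integrable_bound)
    show "integrable lborel std_normal_density" by simp
  qed (auto simp: norm_mult)
  have "char std_normal_distribution ?s = of_real (exp (- ?s\<^sup>2 / 2))"
    by (simp add: char_std_normal_distribution)
  then have val: "(\<integral>t. ?g t \<partial>lborel) = of_real (exp (- ?s\<^sup>2 / 2))"
    unfolding char_def by (subst (asm) integral_density) (auto simp: scaleR_conv_of_real)
  have "integrable lborel (\<lambda>t. ?g (0 + c * t))"
    using c int by (subst lborel_integrable_real_affine_iff) auto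
  then have "integrable lborel (\<lambda>t. of_real (sqrt (2 * pi)) * ?g (0 + c * t))"
    by (rule integrable_mult_right)
  then show "integrable lborel (\<lambda>t. of_real (exp (- (w * t\<^sup>2))) * cis (t * x))"
    unfolding g by (simp add: of_real_divide)
  have "(\<integral>t. ?g t \<partial>lborel) = c *\<^sub>R (\<integral>t. ?g (0 + c * t) \<partial>lborel)"
    using c lborel_integral_real_affine [of c ?g 0] by simp
  also have "\<dots> = of_real (c / sqrt (2 * pi)) * (\<integral>t. of_real (exp (- (w * t\<^sup>2))) * cis (t * x) \<partial>lborel)"
    unfolding g by (simp add: scaleR_conv_of_real)
  finally have "of_real (c / sqrt (2 * pi)) * (\<integral>t. of_real (exp (- (w * t\<^sup>2))) * cis (t * x) \<partial>lborel)
      = of_real (exp (- ?s\<^sup>2 / 2))" using val by simp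
  moreover have "c / sqrt (2 * pi) * (sqrt (pi / w) * exp (- (x\<^sup>2 / (4 * w)))) = exp (- ?s\<^sup>2 / 2)"
    using assms c by (simp add: c_def power_divide real_sqrt_divide real_sqrt_mult)
  ultimately have "of_real (c / sqrt (2 * pi)) * (\<integral>t. of_real (exp (- (w * t\<^sup>2))) * cis (t * x) \<partial>lborel)
     = (of_real (c / sqrt (2 * pi)) :: complex) * of_real (sqrt (pi / w) * exp (- (x\<^sup>2 / (4 * w))))"
    by (metis of_real_mult)
  then show "(\<integral>t. of_real (exp (- (w * t\<^sup>2))) * cis (t * x) \<partial>lborel) =
      of_real (sqrt (pi / w) * exp (- (x\<^sup>2 / (4 * w))))"
    using c by simp
qed

lemma prod_cis: "(\<Prod>i\<in>A. cis (g i)) = cis (\<Sum>i\<in>A. g i)"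
  by (induction A rule: infinite_finite_induct) (auto simp: cis_mult)

text \<open>The Gaussian and the character both factor over the coordinates, while the cosine does
  not; hence the computation with \<open>cis\<close>, with real parts taken only at the end.\<close>

lemma gaussian_fourier:
  fixes x :: "'a::euclidean_space"
  assumes w: "w > 0"
  shows "integrable lborel (\<lambda>\<xi>::'a. exp (- (w * (norm \<xi>)\<^sup>2)))"
    and "(\<integral>\<xi>. exp (- (w * (norm \<xi>)\<^sup>2)) * cos (\<xi> \<bullet> x) \<partial>lborel) =
      sqrt (pi / w) ^ DIM('a) * exp (- ((norm x)\<^sup>2 / (4 * w)))"
proof -
  let ?h = "\<lambda>x b t. of_real (exp (- (w * t\<^sup>2))) * cis (t * (x \<bullet> b))"
  have nrm: "(norm y)\<^sup>2 = (\<Sum>b\<in>Basis. (y \<bullet> b)\<^sup>2)" for y :: 'a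
    by (subst power2_norm_eq_inner, subst euclidean_inner) (simp add: power2_eq_square)
  have eq: "(\<Prod>b\<in>Basis. ?h x b (\<xi> \<bullet> b)) = of_real (exp (- (w * (norm \<xi>)\<^sup>2))) * cis (\<xi> \<bullet> x)" for \<xi> x :: 'a
    by (simp add: prod.distrib prod_cis nrm euclidean_inner [of \<xi> x] flip: of_real_prod exp_sum)
       (simp add: sum_distrib_left sum_negf)
  have int: "integrable lborel (\<lambda>\<xi>::'a. of_real (exp (- (w * (norm \<xi>)\<^sup>2))) * cis (\<xi> \<bullet> x))" for x
    unfolding eq [symmetric] by (rule integrable_lborel_prod) (rule gaussian_fourier_1d [OF w])
  have "integrable lborel (\<lambda>\<xi>::'a. Re (of_real (exp (- (w * (norm \<xi>)\<^sup>2))) * cis (\<xi> \<bullet> 0)))"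
    by (rule integrable_Re [OF int])
  then show "integrable lborel (\<lambda>\<xi>::'a. exp (- (w * (norm \<xi>)\<^sup>2)))"
    by simp
  have "(\<integral>\<xi>. exp (- (w * (norm \<xi>)\<^sup>2)) * cos (\<xi> \<bullet> x) \<partial>lborel) =
      (\<integral>\<xi>. Re (of_real (exp (- (w * (norm \<xi>)\<^sup>2))) * cis (\<xi> \<bullet> x)) \<partial>lborel)"
    by simp
  also have "\<dots> = Re (\<integral>\<xi>. of_real (exp (- (w * (norm \<xi>)\<^sup>2))) * cis (\<xi> \<bullet> x) \<partial>lborel)"
    by (rule integral_Re [OF int])
  also have "(\<integral>\<xi>. of_real (exp (- (w * (norm \<xi>)\<^sup>2))) * cis (\<xi> \<bullet> x) \<partial>lborel) =
      (\<Prod>b\<in>Basis. of_real (sqrt (pi / w) * exp (- ((x \<bullet> b)\<^sup>2 / (4 * w)))))"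
    unfolding eq [symmetric]
    by (subst integral_lborel_prod) (auto simp: gaussian_fourier_1d [OF w])
  also have "\<dots> = of_real (sqrt (pi / w) ^ DIM('a) * exp (- ((norm x)\<^sup>2 / (4 * w))))"
    unfolding of_real_prod [symmetric] prod.distrib prod_constant nrm
    by (simp add: sum_negf sum_divide_distrib flip: exp_sum)
  finally show "(\<integral>\<xi>. exp (- (w * (norm \<xi>)\<^sup>2)) * cos (\<xi> \<bullet> x) \<partial>lborel) =
      sqrt (pi / w) ^ DIM('a) * exp (- ((norm x)\<^sup>2 / (4 * w)))" by simp
qed


section \<open>Linear changes of variables and radial integrals\<close>

lemma nn_integral_lborel_translate:
  fixes h :: "'a::euclidean_space \<Rightarrow> ennreal"
  assumes [measurable]: "h \<in> borel_measurable borel"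
  shows "(\<integral>\<^sup>+x. h (x + a) \<partial>lborel) = (\<integral>\<^sup>+x. h x \<partial>lborel)"
proof -
  have "(\<integral>\<^sup>+x. h x \<partial>lborel) = (\<integral>\<^sup>+x. h x \<partial>distr lborel borel ((+) a))"
    by (simp add: lborel_distr_plus)
  also have "\<dots> = (\<integral>\<^sup>+x. h (a + x) \<partial>lborel)"
    by (subst nn_integral_distr) auto
  finally show ?thesis
    by (simp add: add.commute)
qed

lemma nn_integral_lborel_reflect:
  fixes h :: "'a::euclidean_space \<Rightarrow> ennreal"
  assumes [measurable]: "h \<in> borel_measurable borel"
  shows "(\<integral>\<^sup>+x. h (a - x) \<partial>lborel) = (\<integral>\<^sup>+x. h x \<partial>lborel)"
proof -
  have "(lborel :: 'a measure) = distr lborel borel (\<lambda>x. a + (-1) *\<^sub>R x)"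
    by (subst lborel_affine [of "-1" a]) (auto simp: density_1)
  then have "(\<integral>\<^sup>+x. h x \<partial>lborel) = (\<integral>\<^sup>+x. h x \<partial>distr lborel borel (\<lambda>x. a + (-1) *\<^sub>R x))"
    by simp
  also have "\<dots> = (\<integral>\<^sup>+x. h (a - x) \<partial>lborel)"
    by (subst nn_integral_distr) auto
  finally show ?thesis by simp
qed

text \<open>The library states the linear change of variables only for index types of class \<open>wellorder\<close>.
  Uniqueness of Haar measure replaces it here.\<close>

lemma nn_integral_linear_ratio:
  fixes T T' :: "'a::euclidean_space \<Rightarrow> 'a"
  assumes T: "linear T" and T': "\<And>y. T (T' y) = y"
    and [measurable]: "g \<in> borel_measurable borel" "h \<in> borel_measurable borel"
  shows "(\<integral>\<^sup>+x. h (T x) \<partial>lborel) * (\<integral>\<^sup>+y. g y \<partial>lborel) =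
    (\<integral>\<^sup>+x. g (T x) \<partial>lborel) * (\<integral>\<^sup>+y. h y \<partial>lborel)"
proof -
  have [measurable]: "T \<in> borel_measurable borel"
    using T by (intro borel_measurable_continuous_onI linear_continuous_on)
      (simp add: linear_conv_bounded_linear)
  have "(\<integral>\<^sup>+x. h (T x) \<partial>lborel) * (\<integral>\<^sup>+y. g y \<partial>lborel) =
      (\<integral>\<^sup>+x. \<integral>\<^sup>+y. h (T x) * g y \<partial>lborel \<partial>lborel)"
    by (simp add: nn_integral_cmult nn_integral_multc)
  \<comment> \<open>Shifting y by T x couples the two variables; once the integrals are exchanged,
    shifting x by - \<open>T' y\<close> removes y from the argument of g.\<close>
  also have "\<dots> = (\<integral>\<^sup>+x. \<integral>\<^sup>+y. h (T x) * g (y + T x) \<partial>lborel \<partial>lborel)"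
    by (simp add: nn_integral_cmult nn_integral_lborel_translate)
  also have "\<dots> = (\<integral>\<^sup>+y. \<integral>\<^sup>+x. h (T x) * g (y + T x) \<partial>lborel \<partial>lborel)"
    by (rule lborel_pair.Fubini') measurable
  also have "\<dots> = (\<integral>\<^sup>+y. \<integral>\<^sup>+x. h (T (x + - T' y)) * g (y + T (x + - T' y)) \<partial>lborel \<partial>lborel)"
  proof (rule nn_integral_cong)
    fix y
    show "(\<integral>\<^sup>+x. h (T x) * g (y + T x) \<partial>lborel) =
        (\<integral>\<^sup>+x. h (T (x + - T' y)) * g (y + T (x + - T' y)) \<partial>lborel)"
      by (rule nn_integral_lborel_translate [symmetric]) measurable
  qed
  also have "\<dots> = (\<integral>\<^sup>+y. \<integral>\<^sup>+x. h (T x - y) * g (T x) \<partial>lborel \<partial>lborel)"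
    by (simp add: linear_add [OF T] linear_diff [OF T] linear_neg [OF T] T')
  also have "\<dots> = (\<integral>\<^sup>+x. \<integral>\<^sup>+y. h (T x - y) * g (T x) \<partial>lborel \<partial>lborel)"
    by (rule lborel_pair.Fubini') measurable
  also have "\<dots> = (\<integral>\<^sup>+x. g (T x) * (\<integral>\<^sup>+y. h y \<partial>lborel) \<partial>lborel)"
    by (simp add: nn_integral_multc nn_integral_lborel_reflect mult.commute [of "g _"])
  finally show ?thesis
    by (simp add: nn_integral_multc)
qed

text \<open>A linear map scales volume by a constant; the closed unit ball, its own preimage under T
  and of positive finite volume, shows that the constant is 1.\<close>

lemma distr_lborel_orthogonal:
  fixes T :: "real^'n \<Rightarrow> real^'n"
  assumes "orthogonal_transformation T"
  shows "distr lborel borel T = lborel"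
proof (rule measure_eqI)
  fix A :: "(real^'n) set" assume "A \<in> sets (distr lborel borel T)"
  then have A [measurable]: "A \<in> sets borel" by simp
  have lin: "linear T" and nT: "norm (T x) = norm x" for x
    using assms by (auto simp: orthogonal_transformation)
  have [measurable]: "T \<in> borel_measurable borel"
    using lin by (intro borel_measurable_continuous_onI linear_continuous_on)
      (simp add: linear_conv_bounded_linear)
  have surj: "T (inv T y) = y" for y
    using orthogonal_transformation_surj [OF assms] by (rule surj_f_inv_f)
  let ?B = "cball 0 1 :: (real^'n) set"
  have ind: "indicator S (T x) = indicator (T -` S) x" for S x
    by (simp add: indicator_def)
  have "T -` ?B = ?B" by (auto simp: nT)
  moreover have "T -` A \<in> sets borel"
    using measurable_sets [of T borel borel A] by simp
  moreover have "(\<integral>\<^sup>+x. indicator A (T x) \<partial>lborel) * (\<integral>\<^sup>+y. indicator ?B y \<partial>lborel) =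
      (\<integral>\<^sup>+x. indicator ?B (T x) \<partial>lborel) * (\<integral>\<^sup>+y. indicator A y \<partial>lborel)"
    by (rule nn_integral_linear_ratio [OF lin surj]) (auto intro!: borel_measurable_indicator)
  ultimately have "emeasure lborel (T -` A) * emeasure lborel ?B = emeasure lborel ?B * emeasure lborel A"
    by (simp add: ind)
  moreover have "emeasure lborel ?B \<noteq> 0" "emeasure lborel ?B \<noteq> \<top>"
    using unit_ball_vol_pos [of "real CARD('n)"]
    by (auto simp: emeasure_cball simp del: unit_ball_vol_pos)
  ultimately have "emeasure lborel (T -` A) = emeasure lborel A"
    by (metis ennreal_mult_cancel_left mult.commute)
  then show "emeasure (distr lborel borel T) A = emeasure lborel A"
    by (subst emeasure_distr) auto
qed simp

text \<open>Polar coordinates without a surface measure: both sides agree on half-lines, since the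
  ball of radius sqrt u has volume proportional to u powr (n/2), the integral of the density up to
  u. The variable is the squared radius because its weight is then the Laguerre weight u powr
  \<alpha> with \<alpha> = n/2 - 1.\<close>

lemma distr_lborel_norm_sq:
  "distr lborel borel (\<lambda>x::'a::euclidean_space. (norm x)\<^sup>2) =
    density lborel (\<lambda>u. indicator {0..} u *
      ennreal (pi powr (DIM('a) / 2) / Gamma (DIM('a) / 2) * u powr (DIM('a) / 2 - 1)))"
  (is "?M = density lborel ?d")
proof (rule measure_eqI_generator_eq [where E = "range atMost" and \<Omega> = UNIV and A = "\<lambda>i::nat. {..real i}"])
  let ?n = "real DIM('a)"
  have n: "?n > 0" by simp
  show "Int_stable (range atMost :: real set set)"
    by (auto simp: Int_stable_def)
  have cball: "emeasure ?M {..u} = ennreal (unit_ball_vol ?n * u powr (?n / 2))" if "u \<ge> 0" for u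
  proof -
    have "(\<lambda>x::'a. (norm x)\<^sup>2) -` {..u} = cball 0 (sqrt u)"
      using that by (auto simp: real_le_rsqrt sqrt_le_D)
         (metis abs_norm_cancel real_sqrt_le_iff real_sqrt_abs real_sqrt_le_mono real_sqrt_pow2 power2_eq_square)
    then have "emeasure ?M {..u} = ennreal (unit_ball_vol ?n * sqrt u ^ DIM('a))"
      using that by (subst emeasure_distr) (auto simp: emeasure_cball)
    also have "sqrt u ^ DIM('a) = u powr (?n / 2)"
      using that by (cases "u = 0") (simp_all add: powr_half_sqrt [symmetric] powr_powr flip: powr_realpow)
    finally show ?thesis .
  qed
  have dens: "emeasure (density lborel ?d) {..u} = ennreal (unit_ball_vol ?n * u powr (?n / 2))" if "u \<ge> 0" for u
  proof -
    let ?c = "pi powr (?n / 2) / Gamma (?n / 2)"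
    have c: "?c \<ge> 0" using n by simp
    have G: "Gamma (?n / 2 + 1) = ?n / 2 * Gamma (?n / 2)"
      using n nonpos_Ints_nonpos [of "?n / 2"] by (subst Gamma_plus1) auto
    have "((\<lambda>x. ?c * x powr (?n / 2 - 1)) has_integral ?c * (u powr (?n / 2 - 1 + 1) / (?n / 2 - 1 + 1))) {0..u}"
      using n that by (intro has_integral_mult_right has_integral_powr_from_0) auto
    from nn_integral_has_integral_lebesgue [OF _ this]
    have "(\<integral>\<^sup>+x. indicator {0..u} x * (?c * x powr (?n / 2 - 1)) \<partial>lborel) =
        ennreal (?c * (u powr (?n / 2 - 1 + 1) / (?n / 2 - 1 + 1)))"
      using c by simp
    also have "?c * (u powr (?n / 2 - 1 + 1) / (?n / 2 - 1 + 1)) = unit_ball_vol ?n * u powr (?n / 2)"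
      unfolding unit_ball_vol_def G by (simp add: field_simps)
    also have "(\<integral>\<^sup>+x. indicator {0..u} x * (?c * x powr (?n / 2 - 1)) \<partial>lborel) =
        emeasure (density lborel ?d) {..u}"
      by (subst emeasure_density) (auto intro!: nn_integral_cong simp: indicator_def)
    finally show ?thesis .
  qed
  have neg: "emeasure ?M {..u} = emeasure (density lborel ?d) {..u}" if "u < 0" for u
  proof -
    have "(\<lambda>x::'a. (norm x)\<^sup>2) -` {..u} = {}"
      using that by (auto simp: not_le) (smt (verit) zero_le_power2)
    moreover have "(\<integral>\<^sup>+x. ?d x * indicator {..u} x \<partial>lborel) = (\<integral>\<^sup>+x. 0 \<partial>(lborel :: real measure))"
      using that by (intro nn_integral_cong) (auto simp: indicator_def)
    ultimately show ?thesis
      by (simp add: emeasure_distr emeasure_density)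
  qed
  show "emeasure ?M X = emeasure (density lborel ?d) X" if X: "X \<in> range atMost" for X
  proof -
    obtain u where u: "X = {..u}" using X by blast
    show ?thesis
      unfolding u by (cases "u \<ge> 0") (simp_all only: cball dens neg not_le)
  qed
  show "sets ?M = sigma_sets UNIV (range atMost)"
    by (simp add: borel_eq_atMost)
  show "sets (density lborel ?d) = sigma_sets UNIV (range atMost)"
    by (simp add: borel_eq_atMost)
  show "(\<Union>i. {..real i}) = UNIV"
    by (auto intro: real_arch_simple)
  show "emeasure ?M {..real i} \<noteq> \<infinity>" for i
    by (simp add: cball)
qed (auto intro: range_eqI)

lemma
  fixes g :: "real \<Rightarrow> real"
  assumes [measurable]: "g \<in> borel_measurable borel"
  defines "I \<equiv> \<lambda>u. g u * u powr (DIM('a) / 2 - 1)"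
  shows integrable_radial: "integrable lborel (\<lambda>x::'a::euclidean_space. g ((norm x)\<^sup>2)) \<longleftrightarrow>
      set_integrable lborel {0..} I"
    and integral_radial: "integral\<^sup>L lborel (\<lambda>x::'a. g ((norm x)\<^sup>2)) =
      pi powr (DIM('a) / 2) / Gamma (DIM('a) / 2) * (LINT u:{0..}|lborel. I u)"
proof -
  let ?c = "pi powr (DIM('a) / 2) / Gamma (DIM('a) / 2)"
  let ?d = "\<lambda>u. indicator {0..} u * (?c * u powr (DIM('a) / 2 - 1))"
  have c: "?c > 0" by simp
  have c0: "?c \<noteq> 0"
    by (rule less_imp_neq [OF c, symmetric])
  have d: "(\<lambda>u. indicator {0..} u * ennreal (?c * u powr (DIM('a) / 2 - 1))) = (\<lambda>u. ennreal (?d u))"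
    by (auto simp: indicator_def)
  have nn: "AE u in lborel. 0 \<le> ?d u"
    using c by (auto simp: indicator_def intro!: mult_nonneg_nonneg)
  have eq: "(\<lambda>u. ?d u *\<^sub>R g u) = (\<lambda>u. ?c * (indicator {0..} u *\<^sub>R I u))"
    by (simp add: I_def mult_ac)
  note D = distr_lborel_norm_sq [where 'a = 'a, unfolded d]
  have "integrable lborel (\<lambda>x::'a. g ((norm x)\<^sup>2)) \<longleftrightarrow>
      integrable (distr lborel borel (\<lambda>x::'a. (norm x)\<^sup>2)) g"
    by (subst integrable_distr_eq) auto
  also have "\<dots> \<longleftrightarrow> integrable lborel (\<lambda>u. ?d u *\<^sub>R g u)"
    unfolding D by (rule integrable_density) (use nn in auto)
  finally show "integrable lborel (\<lambda>x::'a. g ((norm x)\<^sup>2)) \<longleftrightarrow> set_integrable lborel {0..} I"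
    unfolding eq set_integrable_def by (simp only: integrable_mult_left_iff c0 simp_thms)
  have "integral\<^sup>L lborel (\<lambda>x::'a. g ((norm x)\<^sup>2)) = integral\<^sup>L (distr lborel borel (\<lambda>x::'a. (norm x)\<^sup>2)) g"
    by (subst integral_distr) auto
  also have "\<dots> = (\<integral>u. ?d u *\<^sub>R g u \<partial>lborel)"
    unfolding D by (rule integral_density) (use nn in auto)
  finally show "integral\<^sup>L lborel (\<lambda>x::'a. g ((norm x)\<^sup>2)) = ?c * (LINT u:{0..}|lborel. I u)"
    unfolding eq set_lebesgue_integral_def by (simp only: integral_mult_right_zero)
qed


section \<open>Differentiation under the integral sign\<close>

lemma power_le_fact_exp:
  fixes x :: real
  assumes "x \<ge> 0"
  shows "x ^ j \<le> fact j * exp x"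
proof -
  obtain t where "exp x = (\<Sum>m<Suc j. x ^ m / fact m) + exp t / fact (Suc j) * x ^ Suc j"
    using Maclaurin_exp_le [of x "Suc j"] by blast
  moreover have "(\<Sum>m<Suc j. x ^ m / fact m) \<ge> x ^ j / fact j"
    using assms by (simp add: sum_nonneg)
  moreover have "exp t / fact (Suc j) * x ^ Suc j \<ge> 0"
    using assms by (intro mult_nonneg_nonneg) auto
  ultimately have "x ^ j / fact j \<le> exp x"
    by linarith
  then show ?thesis
    by (simp add: field_simps)
qed

lemma integrable_laplace_moment:
  fixes u :: "'a \<Rightarrow> real"
  assumes [measurable]: "u \<in> borel_measurable M"
    and u: "\<And>x. u x \<ge> 0"
    and int: "\<And>w. w > 0 \<Longrightarrow> integrable M (\<lambda>x. exp (- (w * u x)))"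
    and w: "w > 0"
  shows "integrable M (\<lambda>x. u x ^ j * exp (- (w * u x)))"
proof (rule Bochner_Integration.integrable_bound)
  \<comment> \<open>Half of the exponential decay is spent on the power: the constant comes from z^j
    \<le> j! exp z at z = w u / 2.\<close>
  show "integrable M (\<lambda>x. fact j * (2 / w) ^ j * exp (- (w / 2 * u x)))"
    using int [of "w / 2"] w by (intro integrable_mult_right) simp
  show "AE x in M. norm (u x ^ j * exp (- (w * u x))) \<le>
      norm (fact j * (2 / w) ^ j * exp (- (w / 2 * u x)))"
  proof (rule AE_I2)
    fix x
    have "(w / 2 * u x) ^ j \<le> fact j * exp (w / 2 * u x)"
      using w u by (intro power_le_fact_exp) simp
    then have "(2 / w) ^ j * (w / 2 * u x) ^ j * exp (- (w * u x)) \<le>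
        (2 / w) ^ j * (fact j * exp (w / 2 * u x)) * exp (- (w * u x))"
      using w by (intro mult_right_mono mult_left_mono) auto
    also have "(2 / w) ^ j * (w / 2 * u x) ^ j = u x ^ j"
      using w by (simp flip: power_mult_distrib)
    also have "(2 / w) ^ j * (fact j * exp (w / 2 * u x)) * exp (- (w * u x)) =
        fact j * (2 / w) ^ j * exp (- (w / 2 * u x))"
      by (simp flip: exp_add)
    finally show "norm (u x ^ j * exp (- (w * u x))) \<le>
        norm (fact j * (2 / w) ^ j * exp (- (w / 2 * u x)))"
      using u w by (simp add: abs_mult)
  qed
qed simp

lemma exp_second_order_bound:
  fixes y :: real
  shows "\<bar>exp y - 1 - y\<bar> \<le> y\<^sup>2 * exp \<bar>y\<bar>"
proof -
  obtain t where t: "\<bar>t\<bar> \<le> \<bar>y\<bar>" and "exp y = (\<Sum>m<2. y ^ m / fact m) + exp t / fact 2 * y ^ 2"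
    using Maclaurin_exp_le [of y 2] by blast
  then have *: "exp y - 1 - y = exp t / 2 * y\<^sup>2"
    by (simp add: numeral_2_eq_2)
  have "\<bar>exp y - 1 - y\<bar> = exp t / 2 * y\<^sup>2"
    unfolding * by (simp add: abs_mult)
  also have "\<dots> \<le> exp \<bar>y\<bar> * y\<^sup>2"
  proof (rule mult_right_mono)
    have "exp t \<le> exp \<bar>y\<bar>" using t by simp
    then show "exp t / 2 \<le> exp \<bar>y\<bar>"
      using exp_gt_zero [of "\<bar>y\<bar>"] by linarith
  qed simp
  finally show ?thesis
    by (simp add: mult.commute)
qed

text \<open>The error of the difference quotient is at most |h| times one integral that serves for
  all |h| < w / 2: half of the rate w absorbs the factor exp (|h| u) in the second-order remainder
  of the exponential. The bounded factor c leaves room for a cosine.\<close>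

lemma has_real_derivative_laplace_moment:
  fixes u c :: "'a \<Rightarrow> real"
  assumes [measurable]: "u \<in> borel_measurable M" "c \<in> borel_measurable M"
    and u: "\<And>x. u x \<ge> 0" and c: "\<And>x. \<bar>c x\<bar> \<le> 1"
    and int: "\<And>w. w > 0 \<Longrightarrow> integrable M (\<lambda>x. exp (- (w * u x)))"
    and w: "w > 0"
  shows "((\<lambda>w. \<integral>x. u x ^ j * exp (- (w * u x)) * c x \<partial>M) has_real_derivative
    - (\<integral>x. u x ^ Suc j * exp (- (w * u x)) * c x \<partial>M)) (at w)"
proof -
  have I: "integrable M (\<lambda>x. u x ^ j * exp (- (v * u x)) * c x)" if "v > 0" for v j
  proof (rule Bochner_Integration.integrable_bound [OF integrable_laplace_moment [of u M v j]])
    show "AE x in M. norm (u x ^ j * exp (- (v * u x)) * c x) \<le> norm (u x ^ j * exp (- (v * u x)))"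
      using c by (auto simp: abs_mult intro!: mult_left_le)
  qed (use u int that in auto)
  let ?D = "\<lambda>w j. \<integral>x. u x ^ j * exp (- (w * u x)) * c x \<partial>M"
  let ?K = "\<integral>x. u x ^ (j + 2) * exp (- (w / 2 * u x)) \<partial>M"
  have "((\<lambda>h. (?D (w + h) j - ?D w j) / h - - ?D w (Suc j)) \<longlongrightarrow> 0) (at 0)"
  proof (rule Lim_null_comparison)
    show "((\<lambda>h. \<bar>h\<bar> * ?K) \<longlongrightarrow> 0) (at 0)"
      by (auto intro!: tendsto_eq_intros)
    have "\<forall>\<^sub>F h in at 0. h \<noteq> 0 \<and> \<bar>h\<bar> < w / 2"
      using w by (auto simp: eventually_at dist_real_def intro!: exI [of _ "w / 2"])
    then show "\<forall>\<^sub>F h in at 0. norm ((?D (w + h) j - ?D w j) / h - - ?D w (Suc j)) \<le> \<bar>h\<bar> * ?K"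
    proof eventually_elim
      case (elim h)
      \<comment> \<open>The pointwise error of the difference quotient, factored so that the
        second-order remainder of exp stands alone.\<close>
      define r where "r x = u x ^ j * exp (- (w * u x)) * c x * ((exp (- (h * u x)) - 1 - - (h * u x)) / h)" for x
      have wh: "w + h > 0" using elim by auto
      have "r x = (u x ^ j * exp (- ((w + h) * u x)) * c x - u x ^ j * exp (- (w * u x)) * c x) / h +
          u x ^ Suc j * exp (- (w * u x)) * c x" for x
        using elim by (simp add: r_def field_simps exp_add [symmetric])
      then have r: "r = (\<lambda>x. (u x ^ j * exp (- ((w + h) * u x)) * c x - u x ^ j * exp (- (w * u x)) * c x) / h +
          u x ^ Suc j * exp (- (w * u x)) * c x)"
        by (rule ext)
      have int_r: "integrable M r"
        unfolding r using I [OF wh] I [OF w]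
        by (intro Bochner_Integration.integrable_add integrable_divide Bochner_Integration.integrable_diff)
      define B where "B = (\<lambda>x. \<bar>h\<bar> * (u x ^ (j + 2) * exp (- (w / 2 * u x))))"
      have int_b: "integrable M B"
        unfolding B_def using w by (intro integrable_mult_right integrable_laplace_moment u int) auto
      have bound: "norm (r x) \<le> B x" for x
      proof -
        have e: "\<bar>h * u x\<bar> \<le> w / 2 * u x"
        proof -
          have "\<bar>h * u x\<bar> = \<bar>h\<bar> * u x"
            using u by (simp add: abs_mult)
          also have "\<dots> \<le> w / 2 * u x"
            using elim u by (intro mult_right_mono) auto
          finally show ?thesis .
        qed
        have "\<bar>exp (- (h * u x)) - 1 - - (h * u x)\<bar> \<le> (h * u x)\<^sup>2 * exp \<bar>h * u x\<bar>"
          using exp_second_order_bound [of "- (h * u x)"] by simp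
        also have "\<dots> \<le> (h * u x)\<^sup>2 * exp (w / 2 * u x)"
          using e by (intro mult_left_mono) auto
        finally have *: "\<bar>exp (- (h * u x)) - 1 - - (h * u x)\<bar> / \<bar>h\<bar> \<le> (h * u x)\<^sup>2 * exp (w / 2 * u x) / \<bar>h\<bar>"
          by (rule divide_right_mono) simp
        have "norm (r x) = u x ^ j * exp (- (w * u x)) * \<bar>c x\<bar> * (\<bar>exp (- (h * u x)) - 1 - - (h * u x)\<bar> / \<bar>h\<bar>)"
          using u by (simp add: r_def abs_mult)
        also have "\<dots> \<le> u x ^ j * exp (- (w * u x)) * 1 * ((h * u x)\<^sup>2 * exp (w / 2 * u x) / \<bar>h\<bar>)"
          using u c by (intro mult_mono * mult_nonneg_nonneg) auto
        also have "\<dots> = \<bar>h\<bar> * (u x ^ (j + 2) * (exp (- (w * u x)) * exp (w / 2 * u x)))"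
        proof -
          have "h\<^sup>2 = \<bar>h\<bar> * \<bar>h\<bar>"
            by (simp add: power2_eq_square)
          then have k: "(h * u x)\<^sup>2 * exp (w / 2 * u x) / \<bar>h\<bar> = \<bar>h\<bar> * ((u x)\<^sup>2 * exp (w / 2 * u x))"
            using elim by (simp only: power_mult_distrib) (simp del: abs_mult_self_eq)
          show ?thesis
            unfolding k power_add by (simp only: mult_1_right mult_ac)
        qed
        also have "exp (- (w * u x)) * exp (w / 2 * u x) = exp (- (w / 2 * u x))"
          by (simp flip: exp_add)
        finally show ?thesis
          by (simp only: B_def)
      qed
      have "(?D (w + h) j - ?D w j) / h - - ?D w (Suc j) = (\<integral>x. r x \<partial>M)"
        unfolding r using I [OF wh, of j] I [OF w, of j] I [OF w, of "Suc j"]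
        by (subst Bochner_Integration.integral_add) (auto simp: Bochner_Integration.integral_diff)
      also have "norm \<dots> \<le> (\<integral>x. norm (r x) \<partial>M)"
        by (rule integral_norm_bound)
      also have "\<dots> \<le> (\<integral>x. B x \<partial>M)"
        by (rule integral_mono [OF integrable_norm [OF int_r] int_b bound])
      also have "\<dots> = \<bar>h\<bar> * ?K"
        unfolding B_def by (rule integral_mult_right_zero)
      finally show ?case .
    qed
  qed
  then show ?thesis
    unfolding DERIV_def by (rule LIM_zero_cancel)
qed

section \<open>Laguerre polynomials: derivative and raising relation\<close>

lemma gbinomial_Suc_mult:
  fixes K :: real
  shows "(real m + 1) * (K gchoose Suc m) = (K - real m) * (K gchoose m)"
  using gbinomial_mult_1 [of K m] by (simp add: algebra_simps)

lemma laguerre_0 [simp]: "laguerre \<alpha> 0 x = 1"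
  by (simp add: laguerre_explicit)

text \<open>The truncated exponent at i = 0 is harmless because of the factor
  \<open>real i\<close>.\<close>

definition laguerre_deriv :: "real \<Rightarrow> nat \<Rightarrow> real \<Rightarrow> real" where
  "laguerre_deriv \<alpha> k x =
     (\<Sum>i\<le>k. (- 1) ^ i * ((real k + \<alpha>) gchoose (k - i)) * (real i * x ^ (i - 1)) / fact i)"

lemma has_real_derivative_laguerre [derivative_intros]:
  "(laguerre \<alpha> k has_real_derivative laguerre_deriv \<alpha> k x) (at x within S)"
  unfolding laguerre_explicit [abs_def] laguerre_deriv_def
  by (auto intro!: derivative_eq_intros sum.cong)

lemma continuous_on_laguerre: "continuous_on S (laguerre \<alpha> k)"
  by (auto simp: laguerre_explicit [abs_def] intro!: continuous_intros)

text \<open>Unlike the three-term recurrence, this raises the degree by means of one polynomial and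
  its derivative, so that differentiation can drive an induction over the degree. The proof compares
  coefficients of (-x)^i / i!.\<close>

lemma laguerre_recurrence:
  "(real k + 1) * laguerre \<alpha> (Suc k) x =
    (real k + \<alpha> + 1 - x) * laguerre \<alpha> k x + x * laguerre_deriv \<alpha> k x"
proof -
  define K where "K = real k + \<alpha>"
  let ?b = "\<lambda>i. K gchoose (k - i)"
  let ?s = "\<lambda>i. (- 1) ^ i * x ^ i / fact i :: real"
  \<comment> \<open>Multiplying by -x moves the coefficient of (-x)^i / i! up one place, at the cost
    of a factor i + 1.\<close>
  have shift: "- x * laguerre \<alpha> k x = (\<Sum>i\<le>k. (real i + 1) * ?b i * ?s (Suc i))"
    unfolding laguerre_explicit sum_distrib_left K_def [symmetric]
  proof (rule sum.cong [OF refl])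
    fix i
    have "real (Suc i) / fact (Suc i) = 1 / fact i"
      by (simp del: of_nat_Suc)
    then have "?b i * ((- 1) ^ Suc i * x ^ Suc i) * (real (Suc i) / fact (Suc i)) =
        ?b i * ((- 1) ^ Suc i * x ^ Suc i) * (1 / fact i)"
      by (simp only:)
    then show "- x * ((- 1) ^ i * ?b i * x ^ i / fact i) = (real i + 1) * ?b i * ?s (Suc i)"
      by (simp add: mult_ac add.commute del: fact_Suc)
  qed
  have "laguerre \<alpha> (Suc k) x = (\<Sum>i\<le>Suc k. ((K + 1) gchoose (Suc k - i)) * ?s i)"
    unfolding laguerre_explicit K_def by (rule sum.cong) (auto simp: field_simps)
  also have "\<dots> = (\<Sum>i\<le>k. ((K + 1) gchoose (Suc k - i)) * ?s i) + ?s (Suc k)"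
    by simp
  finally have "(real k + 1) * laguerre \<alpha> (Suc k) x =
      (\<Sum>i\<le>k. (real k + 1) * ((K + 1) gchoose (Suc k - i)) * ?s i) + (real k + 1) * ?s (Suc k)"
    by (simp only: distrib_left sum_distrib_left mult.assoc)
  also have "(\<Sum>i\<le>k. (real k + 1) * ((K + 1) gchoose (Suc k - i)) * ?s i) =
      (\<Sum>i\<le>k. (K + 1 + real i) * ?b i * ?s i + real i * (K gchoose (Suc k - i)) * ?s i)"
  proof (rule sum.cong [OF refl])
    fix i assume "i \<in> {..k}"
    then obtain m where k: "k = i + m" by (auto simp: le_iff_add)
    \<comment> \<open>With k + 1 = (m + 1) + i, absorption turns the first part into (K + 1) times
      \<open>?b i\<close>, and Pascal's rule splits the second.\<close>
    have "(real k + 1) * ((K + 1) gchoose (Suc k - i)) =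
        (K + 1 + real i) * ?b i + real i * (K gchoose (Suc k - i))"
      using gbinomial_Suc_mult [of m K] gbinomial_Suc_Suc [of K m]
      by (simp add: k Suc_diff_le algebra_simps)
    then show "(real k + 1) * ((K + 1) gchoose (Suc k - i)) * ?s i =
        (K + 1 + real i) * ?b i * ?s i + real i * (K gchoose (Suc k - i)) * ?s i"
      by (simp only: distrib_right)
  qed
  also have "\<dots> = (\<Sum>i\<le>k. (K + 1 + real i) * ?b i * ?s i) + (\<Sum>i\<le>k. real i * (K gchoose (Suc k - i)) * ?s i)"
    by (rule sum.distrib)
  also note add.assoc
  also have "(\<Sum>i\<le>k. real i * (K gchoose (Suc k - i)) * ?s i) + (real k + 1) * ?s (Suc k) =
      (\<Sum>i\<le>Suc k. real i * (K gchoose (Suc k - i)) * ?s i)"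
    by (simp add: add.commute [of 1] del: fact_Suc)
  also have "\<dots> = - x * laguerre \<alpha> k x"
    unfolding shift by (subst sum.atMost_Suc_shift) (simp add: add.commute)
  also have "(\<Sum>i\<le>k. (K + 1 + real i) * ?b i * ?s i) =
      (K + 1) * laguerre \<alpha> k x + x * laguerre_deriv \<alpha> k x"
    unfolding laguerre_explicit laguerre_deriv_def sum_distrib_left K_def [symmetric] sum.distrib [symmetric]
  proof (rule sum.cong [OF refl])
    fix i
    have e: "x * (real i * x ^ (i - 1)) = real i * x ^ i"
      by (cases i) auto
    have "x * ((- 1) ^ i * ?b i * (real i * x ^ (i - 1)) / fact i) =
        (- 1) ^ i * ?b i * (x * (real i * x ^ (i - 1))) / fact i"
      by simp
    also have "\<dots> = real i * ?b i * ?s i"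
      unfolding e by simp
    finally have fin: "x * ((- 1) ^ i * ?b i * (real i * x ^ (i - 1)) / fact i) = real i * ?b i * ?s i" .
    have bs: "(- 1) ^ i * ?b i * x ^ i / fact i = ?b i * ?s i"
      by simp
    show "(K + 1 + real i) * ?b i * ?s i = (K + 1) * ((- 1) ^ i * ?b i * x ^ i / fact i) +
        x * ((- 1) ^ i * ?b i * (real i * x ^ (i - 1)) / fact i)"
      unfolding fin bs by (simp only: distrib_right mult.assoc)
  qed
  finally show ?thesis
    by (simp add: K_def algebra_simps)
qed


section \<open>Fourier transforms of Gaussian moments\<close>

text \<open>The exponent of w is the one for which all terms of the product rule share a common
  power, leaving exactly the right side of \<open>laguerre_recurrence\<close> at x = s / w.\<close>

lemma has_real_derivative_laguerre_scaled:
  fixes \<alpha> s w :: real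
  assumes w: "w > 0"
  shows "((\<lambda>w. w powr (- (\<alpha> + 1) - real j) * laguerre \<alpha> j (s / w) * exp (- (s / w)))
    has_real_derivative
      - ((real j + 1) * (w powr (- (\<alpha> + 1) - real (Suc j)) * laguerre \<alpha> (Suc j) (s / w) * exp (- (s / w)))))
    (at w)"
proof -
  let ?e = "- (\<alpha> + 1) - real j" and ?x = "s / w"
  have p: "w powr ?e = w * w powr (- (\<alpha> + 1) - real (Suc j))"
    using w powr_mult_base [of w "- (\<alpha> + 1) - real (Suc j)"] by (simp add: algebra_simps)
  have q: "w powr (?e - 1) = w powr (- (\<alpha> + 1) - real (Suc j))"
    by (simp add: algebra_simps)
  have d1: "((\<lambda>w. w powr ?e) has_real_derivative ?e * w powr (?e - 1)) (at w)"
    using w by (rule has_real_derivative_powr)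
  have d0: "((\<lambda>w. s / w) has_real_derivative - (s / w\<^sup>2)) (at w)"
    using w by (auto intro!: derivative_eq_intros simp: power2_eq_square)
  have d2: "((\<lambda>w. laguerre \<alpha> j (s / w)) has_real_derivative laguerre_deriv \<alpha> j ?x * (- (s / w\<^sup>2))) (at w)"
    by (rule DERIV_chain2 [OF has_real_derivative_laguerre d0])
  have d3: "((\<lambda>w. exp (- (s / w))) has_real_derivative exp (- ?x) * (s / w\<^sup>2)) (at w)"
    using DERIV_chain2 [OF DERIV_exp DERIV_minus [OF d0]] by simp
  let ?W = "w powr (- (\<alpha> + 1) - real (Suc j))"
  have sw: "w * (s / w\<^sup>2) = ?x"
    using w by (simp add: power2_eq_square)
  have "((\<lambda>w. w powr ?e * laguerre \<alpha> j (s / w) * exp (- (s / w))) has_real_derivative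
      (?e * ?W * laguerre \<alpha> j ?x + laguerre_deriv \<alpha> j ?x * (- (s / w\<^sup>2)) * w powr ?e) * exp (- ?x) +
      exp (- ?x) * (s / w\<^sup>2) * (w powr ?e * laguerre \<alpha> j ?x)) (at w)"
    using DERIV_mult [OF DERIV_mult [OF d1 d2] d3] unfolding q by simp
  also have "(?e * ?W * laguerre \<alpha> j ?x + laguerre_deriv \<alpha> j ?x * (- (s / w\<^sup>2)) * w powr ?e) * exp (- ?x) +
      exp (- ?x) * (s / w\<^sup>2) * (w powr ?e * laguerre \<alpha> j ?x) =
      - ?W * exp (- ?x) * (- ?e * laguerre \<alpha> j ?x + (w * (s / w\<^sup>2)) * laguerre_deriv \<alpha> j ?x
         - (w * (s / w\<^sup>2)) * laguerre \<alpha> j ?x)"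
    unfolding p by (simp add: algebra_simps)
  also have "\<dots> = - ?W * exp (- ?x) * ((real j + 1) * laguerre \<alpha> (Suc j) ?x)"
    unfolding sw laguerre_recurrence by (simp add: algebra_simps)
  finally show ?thesis
    by (simp add: algebra_simps)
qed

lemma sqrt_power_powr:
  assumes "w > 0"
  shows "sqrt w ^ n = w powr (real n / 2)"
proof -
  have "sqrt w ^ n = (w powr (1 / 2)) powr real n"
    using assms by (subst powr_realpow) (simp_all add: powr_half_sqrt)
  then show ?thesis
    by (simp add: powr_powr)
qed

lemma integrable_gaussian_moment:
  assumes "w > 0"
  shows "integrable lborel (\<lambda>\<xi>::'a::euclidean_space. ((norm \<xi>)\<^sup>2) ^ j * exp (- (w * (norm \<xi>)\<^sup>2)))"
  by (rule integrable_laplace_moment) (use assms gaussian_fourier(1) in auto)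

text \<open>Induction over j by differentiating in w: on the left this brings down - |\<xi>|^2, on
  the right it raises the Laguerre degree, and uniqueness of the derivative gives the next
  case.\<close>

lemma gaussian_moment_fourier:
  fixes x :: "'a::euclidean_space"
  assumes w: "w > 0"
  shows "(\<integral>\<xi>. ((norm \<xi>)\<^sup>2) ^ j * exp (- (w * (norm \<xi>)\<^sup>2)) * cos (\<xi> \<bullet> x) \<partial>lborel) =
    sqrt pi ^ DIM('a) * fact j * (w powr (- (DIM('a) / 2) - real j) *
      laguerre (DIM('a) / 2 - 1) j ((norm x)\<^sup>2 / 4 / w) * exp (- ((norm x)\<^sup>2 / 4 / w)))"
  using w
proof (induction j arbitrary: w)
  case 0
  have "sqrt (pi / w) ^ DIM('a) = sqrt pi ^ DIM('a) * w powr (- (DIM('a) / 2))"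
    unfolding real_sqrt_divide power_divide sqrt_power_powr [OF 0] powr_minus
    by (simp only: divide_inverse)
  then show ?case
    using gaussian_fourier(2) [OF 0, of x] by simp
next
  case (Suc j)
  let ?n = "real DIM('a)"
  let ?G = "\<lambda>j w. \<integral>\<xi>. ((norm \<xi>)\<^sup>2) ^ j * exp (- (w * (norm \<xi>)\<^sup>2)) * cos (\<xi> \<bullet> x) \<partial>lborel"
  let ?s = "(norm x)\<^sup>2 / 4"
  let ?L = "\<lambda>j w. w powr (- (?n / 2) - real j) * laguerre (?n / 2 - 1) j (?s / w) * exp (- (?s / w))"
  let ?c = "sqrt pi ^ DIM('a) * fact j :: real"
  have "(?G j has_real_derivative - ?G (Suc j) w) (at w)"
    by (rule has_real_derivative_laplace_moment) (use Suc.prems gaussian_fourier(1) in auto)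
  \<comment> \<open>The induction hypothesis is available for positive parameters only, so the
    derivative is transferred along an agreement near w.\<close>
  moreover have "(?G j has_real_derivative ?c * - ((real j + 1) * ?L (Suc j) w)) (at w)"
  proof (rule DERIV_cong_ev [THEN iffD1, OF refl _ refl])
    show "((\<lambda>w. ?c * ?L j w) has_real_derivative ?c * - ((real j + 1) * ?L (Suc j) w)) (at w)"
      using DERIV_cmult [OF has_real_derivative_laguerre_scaled [OF Suc.prems, of "?n / 2 - 1" j ?s], of ?c]
      by simp
    have "\<forall>\<^sub>F v in nhds w. v > 0"
      using Suc.prems by (rule order_tendstoD(1) [OF filterlim_ident])
    then show "\<forall>\<^sub>F v in nhds w. ?c * ?L j v = ?G j v"
      by eventually_elim (simp add: Suc.IH)
  qed
  ultimately have "- ?G (Suc j) w = ?c * - ((real j + 1) * ?L (Suc j) w)"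
    by (rule DERIV_unique)
  then show ?case
    by (simp add: algebra_simps)
qed

text \<open>At the origin the raising relation loses its derivative term. The ratio is the mean of
  the Gamma distribution with shape n/2 + j and rate w, the law of |\<xi>|^2 under the normalised
  weight.\<close>

lemma gaussian_moment_Suc:
  assumes w: "w > 0"
  shows "(\<integral>\<xi>. ((norm (\<xi> :: 'a::euclidean_space))\<^sup>2) ^ Suc j * exp (- (w * (norm \<xi>)\<^sup>2)) \<partial>lborel) =
    (DIM('a) / 2 + real j) / w * (\<integral>\<xi>. ((norm (\<xi> :: 'a))\<^sup>2) ^ j * exp (- (w * (norm \<xi>)\<^sup>2)) \<partial>lborel)"
proof -
  let ?n = "real DIM('a)" and ?l = "\<lambda>j. laguerre (DIM('a) / 2 - 1) j 0"
  have rec: "(real j + 1) * ?l (Suc j) = (?n / 2 + real j) * ?l j"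
    using laguerre_recurrence [of j "?n / 2 - 1" 0] by (simp add: add.commute)
  have pw: "w powr (- (?n / 2) - real (Suc j)) = w powr (- (?n / 2) - real j) / w"
    using w powr_diff [of w "- (?n / 2) - real j" 1] by (simp add: algebra_simps)
  have m: "(\<integral>\<xi>. ((norm (\<xi> :: 'a))\<^sup>2) ^ j * exp (- (w * (norm \<xi>)\<^sup>2)) \<partial>lborel) =
      sqrt pi ^ DIM('a) * fact j * (w powr (- (?n / 2) - real j) * ?l j)" for j
    using gaussian_moment_fourier [OF w, of j "0::'a"] by simp
  have "sqrt pi ^ DIM('a) * fact (Suc j) * (w powr (- (?n / 2) - real (Suc j)) * ?l (Suc j)) =
      sqrt pi ^ DIM('a) * fact j * (w powr (- (?n / 2) - real j) / w * ((real j + 1) * ?l (Suc j)))"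
    unfolding pw by (simp add: algebra_simps add_divide_distrib)
  also have "\<dots> = (?n / 2 + real j) / w * (sqrt pi ^ DIM('a) * fact j * (w powr (- (?n / 2) - real j) * ?l j))"
    unfolding rec by simp
  finally show ?thesis
    unfolding m .
qed

lemma gaussian_moment_pos:
  assumes w: "w > 0"
  shows "(\<integral>\<xi>. ((norm (\<xi> :: 'a::euclidean_space))\<^sup>2) ^ j * exp (- (w * (norm \<xi>)\<^sup>2)) \<partial>lborel) > 0"
proof (induction j)
  case 0
  show ?case
    using gaussian_fourier(2) [OF w, of "0::'a"] w by simp
next
  case (Suc j)
  have "real DIM('a) / 2 + real j > 0"
    by (simp add: add_pos_nonneg)
  then show ?case
    unfolding gaussian_moment_Suc [OF w] using Suc w by simp
qed


section \<open>Nonnegativity of the cosine transform\<close>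

text \<open>The real part of the Fourier transform, without 2 pi in the exponent. For an even
  function it is the whole transform, and squared moduli of exponential sums expand into cosines
  only.\<close>

definition cosine_transform :: "('a::euclidean_space \<Rightarrow> real) \<Rightarrow> 'a \<Rightarrow> real" where
  "cosine_transform F \<xi> = (\<integral>x. F x * cos (\<xi> \<bullet> x) \<partial>lborel)"

lemma integrable_mult_cos:
  fixes F :: "'a::euclidean_space \<Rightarrow> real"
  assumes "integrable lborel F"
  shows "integrable lborel (\<lambda>x. F x * cos (\<xi> \<bullet> x))"
proof (rule Bochner_Integration.integrable_bound [OF assms])
  show "(\<lambda>x. F x * cos (\<xi> \<bullet> x)) \<in> borel_measurable lborel"
    using borel_measurable_integrable [OF assms] by measurable
  show "AE x in lborel. norm (F x * cos (\<xi> \<bullet> x)) \<le> norm (F x)"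
    by (auto simp: abs_mult intro!: mult_left_le)
qed

lemma abs_cosine_transform_le:
  assumes "integrable lborel F"
  shows "\<bar>cosine_transform F \<xi>\<bar> \<le> (\<integral>x. \<bar>F x\<bar> \<partial>lborel)"
proof -
  have "\<bar>cosine_transform F \<xi>\<bar> \<le> (\<integral>x. \<bar>F x * cos (\<xi> \<bullet> x)\<bar> \<partial>lborel)"
    unfolding cosine_transform_def by (rule integral_abs_bound)
  also have "\<dots> \<le> (\<integral>x. \<bar>F x\<bar> \<partial>lborel)"
    by (intro integral_mono integrable_abs integrable_mult_cos assms)
      (auto simp: abs_mult intro!: mult_left_le)
  finally show ?thesis .
qed

lemma continuous_on_cosine_transform:
  fixes F :: "'a::euclidean_space \<Rightarrow> real"
  assumes F: "integrable lborel F"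
  shows "continuous_on UNIV (cosine_transform F)"
proof (intro continuous_at_imp_continuous_on ballI)
  fix \<xi> :: 'a
  have [measurable]: "F \<in> borel_measurable borel"
    using borel_measurable_integrable [OF F] by simp
  show "isCont (cosine_transform F) \<xi>"
    unfolding continuous_at_sequentially o_def
  proof (intro allI impI)
    fix s :: "nat \<Rightarrow> 'a" assume s: "s \<longlonglongrightarrow> \<xi>"
    show "(\<lambda>n. cosine_transform F (s n)) \<longlonglongrightarrow> cosine_transform F \<xi>"
      unfolding cosine_transform_def
    proof (rule integral_dominated_convergence [where w = "\<lambda>x. \<bar>F x\<bar>"])
      show "AE x in lborel. (\<lambda>n. F x * cos (s n \<bullet> x)) \<longlonglongrightarrow> F x * cos (\<xi> \<bullet> x)"
        using s by (intro AE_I2 tendsto_intros)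
      show "AE x in lborel. norm (F x * cos (s n \<bullet> x)) \<le> \<bar>F x\<bar>" for n
        by (auto simp: abs_mult intro!: mult_left_le)
    qed (use F in auto)
  qed
qed

lemma cosine_transform_orthogonal:
  fixes F :: "real^'n \<Rightarrow> real"
  assumes [measurable]: "F \<in> borel_measurable borel"
    and rad: "\<And>x y. norm x = norm y \<Longrightarrow> F x = F y"
    and n: "norm \<xi> = norm \<eta>"
  shows "cosine_transform F \<xi> = cosine_transform F \<eta>"
proof -
  obtain T where T: "orthogonal_transformation T" "T \<xi> = \<eta>"
    using orthogonal_transformation_exists [OF n] by blast
  have lin: "linear T" and nT: "norm (T x) = norm x" and iT: "T x \<bullet> T y = x \<bullet> y" for x y
    using T(1) by (auto simp: orthogonal_transformation_def orthogonal_transformation_norm)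
  have [measurable]: "T \<in> borel_measurable borel"
    using lin by (intro borel_measurable_continuous_onI linear_continuous_on)
      (simp add: linear_conv_bounded_linear)
  have "cosine_transform F \<eta> = (\<integral>x. F x * cos (\<eta> \<bullet> x) \<partial>distr lborel borel T)"
    by (simp add: distr_lborel_orthogonal [OF T(1)] cosine_transform_def)
  also have "\<dots> = (\<integral>x. F (T x) * cos (\<eta> \<bullet> T x) \<partial>lborel)"
    by (subst integral_distr) auto
  also have "\<dots> = cosine_transform F \<xi>"
    unfolding cosine_transform_def T(2) [symmetric] iT using rad [OF nT] by simp
  finally show ?thesis by simp
qed

text \<open>The integrand is dominated by |F x| |h \<xi>|, which is integrable on the product space,
  so Fubini applies.\<close>

lemma integral_cosine_transform_mult:
  fixes F h :: "'a::euclidean_space \<Rightarrow> real"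
  assumes F: "integrable lborel F" and h: "integrable lborel h"
  shows "(\<integral>\<xi>. cosine_transform F \<xi> * h \<xi> \<partial>lborel) = (\<integral>x. F x * cosine_transform h x \<partial>lborel)"
proof -
  have [measurable]: "F \<in> borel_measurable borel" "h \<in> borel_measurable borel"
    using borel_measurable_integrable [OF F] borel_measurable_integrable [OF h] by auto
  let ?k = "\<lambda>x \<xi>. F x * (h \<xi> * cos (x \<bullet> \<xi>))"
  have int: "integrable (lborel \<Otimes>\<^sub>M lborel) (case_prod ?k)"
  proof (rule lborel_pair.Fubini_integrable)
    show "case_prod ?k \<in> borel_measurable (lborel \<Otimes>\<^sub>M lborel)"
      by measurable
    have i: "integrable lborel (\<lambda>\<xi>. \<bar>?k x \<xi>\<bar>)" for x
      using integrable_mult_cos [OF h, of x] by (intro integrable_abs integrable_mult_right)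
    show "AE x in lborel. integrable lborel (\<lambda>\<xi>. case_prod ?k (x, \<xi>))"
      using integrable_mult_cos [OF h] by (auto intro!: AE_I2)
    show "integrable lborel (\<lambda>x. \<integral>\<xi>. norm (case_prod ?k (x, \<xi>)) \<partial>lborel)"
    proof (rule Bochner_Integration.integrable_bound)
      show "integrable lborel (\<lambda>x. \<bar>F x\<bar> * (\<integral>\<xi>. \<bar>h \<xi>\<bar> \<partial>lborel))"
        using F by (intro integrable_mult_left) auto
      show "(\<lambda>x. \<integral>\<xi>. norm (case_prod ?k (x, \<xi>)) \<partial>lborel) \<in> borel_measurable lborel"
        by measurable
      show "AE x in lborel. norm (\<integral>\<xi>. norm (case_prod ?k (x, \<xi>)) \<partial>lborel) \<le>
          norm (\<bar>F x\<bar> * (\<integral>\<xi>. \<bar>h \<xi>\<bar> \<partial>lborel))"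
      proof (rule AE_I2)
        fix x
        have "(\<integral>\<xi>. \<bar>?k x \<xi>\<bar> \<partial>lborel) \<le> (\<integral>\<xi>. \<bar>F x\<bar> * \<bar>h \<xi>\<bar> \<partial>lborel)"
          using i h by (intro integral_mono) (auto simp: abs_mult intro!: mult_left_mono mult_left_le)
        then show "norm (\<integral>\<xi>. norm (case_prod ?k (x, \<xi>)) \<partial>lborel) \<le>
            norm (\<bar>F x\<bar> * (\<integral>\<xi>. \<bar>h \<xi>\<bar> \<partial>lborel))"
          by (simp add: abs_mult)
      qed
    qed
  qed
  have fub: "(\<integral>\<xi>. \<integral>x. ?k x \<xi> \<partial>lborel \<partial>lborel) = (\<integral>x. \<integral>\<xi>. ?k x \<xi> \<partial>lborel \<partial>lborel)"
    by (rule lborel_pair.Fubini_integral [OF int])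
  have k1: "(\<integral>x. ?k x \<xi> \<partial>lborel) = cosine_transform F \<xi> * h \<xi>" for \<xi>
    unfolding cosine_transform_def
    by (subst integral_mult_left_zero [symmetric]) (simp add: mult_ac inner_commute)
  have k2: "(\<integral>\<xi>. ?k x \<xi> \<partial>lborel) = F x * cosine_transform h x" for x
    unfolding cosine_transform_def by (rule integral_mult_right_zero)
  show ?thesis
    using fub unfolding k1 k2 .
qed

text \<open>Substituting y u for the integration variable and reading u as |x|^2 turns the
  coefficient into this integral, up to positive factors: y, \<open>y powr \<alpha>\<close>, the
  Laguerre normalisation and the constant of the radial formula.\<close>

lemma integral_laguerre_nonneg:
  fixes f :: "real \<Rightarrow> real"
  assumes [measurable]: "f \<in> borel_measurable borel"
    and a: "laguerre_coeff (DIM('a) / 2 - 1) (\<lambda>x. f (x / y)) j \<ge> 0" and y: "y > 0"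
  shows "(\<integral>x. f ((norm (x :: 'a::euclidean_space))\<^sup>2) *
    (laguerre (DIM('a) / 2 - 1) j (y * (norm x)\<^sup>2) * exp (- (y * (norm x)\<^sup>2))) \<partial>lborel) \<ge> 0"
proof -
  define \<alpha> where "\<alpha> = real DIM('a) / 2 - 1"
  have [measurable]: "laguerre \<alpha> j \<in> borel_measurable borel"
    by (rule borel_measurable_continuous_onI [OF continuous_on_laguerre])
  let ?g = "\<lambda>u. f u * (laguerre \<alpha> j (y * u) * exp (- (y * u)))"
  let ?H = "\<lambda>x. indicator {0..} x *\<^sub>R (f (x / y) * laguerre \<alpha> j x * x powr \<alpha> * exp (- x))"
  define g where "g = Gamma (real j + \<alpha> + 1) / fact j"
  have g: "g > 0"
    by (simp add: g_def \<alpha>_def add_nonneg_pos)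
  have "laguerre_coeff \<alpha> (\<lambda>x. f (x / y)) j = (\<integral>x. ?H x \<partial>lborel) / g"
    by (simp add: laguerre_coeff_def set_lebesgue_integral_def g_def)
  then have "(\<integral>x. ?H x \<partial>lborel) \<ge> 0"
    using a g unfolding \<alpha>_def [symmetric] by (simp only: zero_le_divide_iff) auto
  also have "(\<integral>x. ?H x \<partial>lborel) = y * (\<integral>x. ?H (0 + y * x) \<partial>lborel)"
    using y lborel_integral_real_affine [of y ?H 0] by simp
  also have "(\<lambda>x. ?H (0 + y * x)) = (\<lambda>u. y powr \<alpha> * (indicator {0..} u *\<^sub>R (?g u * u powr \<alpha>)))"
    using y by (auto simp: fun_eq_iff indicator_def powr_mult zero_le_mult_iff)
  also have "(\<integral>u. y powr \<alpha> * (indicator {0..} u *\<^sub>R (?g u * u powr \<alpha>)) \<partial>lborel) =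
      y powr \<alpha> * (LINT u:{0..}|lborel. ?g u * u powr \<alpha>)"
    unfolding set_lebesgue_integral_def by (rule integral_mult_right_zero)
  finally have "(LINT u:{0..}|lborel. ?g u * u powr \<alpha>) \<ge> 0"
    using y by (simp add: zero_le_mult_iff)
  moreover have "Gamma (real DIM('a) / 2) > 0"
    by simp
  ultimately show ?thesis
    using integral_radial [of ?g, where 'a = 'a] unfolding \<alpha>_def [symmetric] by simp
qed

text \<open>As in Korovkin's theorem, it suffices that the first two moments of the Gaussian weights, as functions
  of \<open>|\<xi>|\<^sup>2\<close>, converge to those of a point mass.\<close>

lemma radial_nonneg_of_gaussian_moments:
  fixes \<phi> :: "'a::euclidean_space \<Rightarrow> real"
  assumes cont: "continuous_on UNIV \<phi>" and bd: "\<And>\<xi>. \<bar>\<phi> \<xi>\<bar> \<le> B"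
    and rad: "\<And>\<xi> \<eta>. norm \<xi> = norm \<eta> \<Longrightarrow> \<phi> \<xi> = \<phi> \<eta>"
    and pos: "\<And>j w. w > 0 \<Longrightarrow>
      (\<integral>\<xi>. \<phi> \<xi> * (((norm \<xi>)\<^sup>2) ^ j * exp (- (w * (norm \<xi>)\<^sup>2))) \<partial>lborel) \<ge> 0"
  shows "\<phi> \<xi>\<^sub>0 \<ge> 0"
proof (rule ccontr)
  assume "\<not> \<phi> \<xi>\<^sub>0 \<ge> 0"
  then have neg: "\<phi> \<xi>\<^sub>0 < 0" by simp
  define s where "s = norm \<xi>\<^sub>0"
  define t where "t = s\<^sup>2"
  have B: "B \<ge> 0" using bd [of 0] by linarith
  obtain e :: 'a where e: "norm e = 1" "\<xi>\<^sub>0 = s *\<^sub>R e"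
  proof (cases "\<xi>\<^sub>0 = 0")
    case True
    obtain b :: 'a where "b \<in> Basis" using nonempty_Basis by blast
    then show ?thesis using True that [of b] by (simp add: s_def)
  next
    case False
    then show ?thesis using that [of "\<xi>\<^sub>0 /\<^sub>R s"] by (simp add: s_def)
  qed
  have "isCont \<phi> \<xi>\<^sub>0" using cont by (simp add: continuous_on_eq_continuous_at)
  then obtain d where d: "d > 0" "\<And>\<eta>. dist \<eta> \<xi>\<^sub>0 < d \<Longrightarrow> dist (\<phi> \<eta>) (\<phi> \<xi>\<^sub>0) < - \<phi> \<xi>\<^sub>0 / 2"
    using neg by (auto simp: continuous_at_eps_delta dest!: spec [of _ "- \<phi> \<xi>\<^sub>0 / 2"])
  \<comment> \<open>Where |\<xi>|^2 is at least d^2 away from t, the quadratic term is at least C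
    d^4 = 2 B, enough to dominate any value of \<phi>.\<close>
  define C where "C = 2 * B / d ^ 4"
  have C: "C \<ge> 0" using B d by (simp add: C_def)
  have bound: "\<phi> \<xi> \<le> \<phi> \<xi>\<^sub>0 / 2 + C * ((norm \<xi>)\<^sup>2 - t)\<^sup>2" for \<xi>
  proof (cases "\<bar>(norm \<xi>)\<^sup>2 - t\<bar> < d\<^sup>2")
    case True
    have s0: "s \<ge> 0" by (simp add: s_def)
    \<comment> \<open>From |r - s|^2 \<le> |r - s| (r + s) = |r^2 - s^2|, closeness d^2 of the
      squares gives closeness d of the radii. Radial symmetry then moves \<xi> onto the ray through
      e, next to \<open>\<xi>\<^sub>0\<close>.\<close>
    have "\<bar>norm \<xi> - s\<bar> \<le> norm \<xi> + s" using s0 norm_ge_zero [of \<xi>] by linarith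
    then have "\<bar>norm \<xi> - s\<bar>\<^sup>2 \<le> \<bar>norm \<xi> - s\<bar> * (norm \<xi> + s)"
      unfolding power2_eq_square by (rule mult_left_mono) simp
    also have "\<dots> = \<bar>(norm \<xi> - s) * (norm \<xi> + s)\<bar>"
      using s0 by (simp add: abs_mult)
    also have "(norm \<xi> - s) * (norm \<xi> + s) = (norm \<xi>)\<^sup>2 - t"
      by (simp add: t_def power2_eq_square algebra_simps)
    also note True
    finally have "\<bar>norm \<xi> - s\<bar> < d"
      using d by (simp add: power2_less_imp_less)
    moreover have "norm (norm \<xi> *\<^sub>R e - s *\<^sub>R e) = \<bar>norm \<xi> - s\<bar>"
      using e by (simp flip: scaleR_diff_left)
    ultimately have "dist (norm \<xi> *\<^sub>R e) \<xi>\<^sub>0 < d"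
      using e by (simp add: dist_norm)
    then have "\<phi> (norm \<xi> *\<^sub>R e) \<le> \<phi> \<xi>\<^sub>0 / 2"
      using d(2) [of "norm \<xi> *\<^sub>R e"] by (simp add: dist_real_def abs_if split: if_splits)
    moreover have "\<phi> \<xi> = \<phi> (norm \<xi> *\<^sub>R e)" by (rule rad) (simp add: e)
    moreover have "C * ((norm \<xi>)\<^sup>2 - t)\<^sup>2 \<ge> 0" using C by simp
    ultimately show ?thesis by linarith
  next
    case False
    then have "(d\<^sup>2)\<^sup>2 \<le> \<bar>(norm \<xi>)\<^sup>2 - t\<bar>\<^sup>2"
      by (intro power_mono) auto
    then have "C * d ^ 4 \<le> C * ((norm \<xi>)\<^sup>2 - t)\<^sup>2"
      using C by (intro mult_left_mono) auto
    moreover have "C * d ^ 4 = 2 * B" using d by (simp add: C_def)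
    ultimately show ?thesis using bd [of \<xi>] bd [of \<xi>\<^sub>0] neg by linarith
  qed
  let ?n = "real DIM('a)"
  \<comment> \<open>For the weight with exponent j and w = k + 1, \<open>a k j\<close> is the mean
    of |\<xi>|^2 and \<open>V k j\<close> its mean squared deviation from t; the second moment is a
    product of two consecutive ratios.\<close>
  define a where "a k j = (?n / 2 + real j) / real (Suc k)" for k j
  define V where "V k j = a k j * a k (Suc j) - 2 * t * a k j + t\<^sup>2" for k j
  have V: "- \<phi> \<xi>\<^sub>0 / 2 \<le> C * V k j" for k j
  proof -
    define w where "w = real (Suc k)"
    have w: "w > 0" by (simp add: w_def)
    define m where "m i = (\<lambda>\<xi>::'a. ((norm \<xi>)\<^sup>2) ^ i * exp (- (w * (norm \<xi>)\<^sup>2)))" for i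
    define M where "M i = (\<integral>\<xi>. m i \<xi> \<partial>lborel)" for i
    have int: "integrable lborel (m i)" for i
      unfolding m_def by (rule integrable_gaussian_moment [OF w])
    have M: "M (Suc i) = a k i * M i" for i
      unfolding M_def m_def a_def w_def [symmetric] by (rule gaussian_moment_Suc [OF w])
    have Mp: "M j > 0"
      unfolding M_def m_def by (rule gaussian_moment_pos [OF w])
    have [measurable]: "\<phi> \<in> borel_measurable borel"
      using cont by (rule borel_measurable_continuous_onI)
    have i1: "integrable lborel (\<lambda>\<xi>. \<phi> \<xi> * m j \<xi>)"
    proof (rule Bochner_Integration.integrable_bound)
      show "integrable lborel (\<lambda>\<xi>. B * m j \<xi>)" using int by simp
      show "(\<lambda>\<xi>. \<phi> \<xi> * m j \<xi>) \<in> borel_measurable lborel"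
        unfolding m_def by measurable
      show "AE \<xi> in lborel. norm (\<phi> \<xi> * m j \<xi>) \<le> norm (B * m j \<xi>)"
        using bd B by (auto simp: abs_mult intro!: mult_right_mono)
    qed
    let ?q = "\<lambda>\<xi>. \<phi> \<xi>\<^sub>0 / 2 * m j \<xi> + C * (m (Suc (Suc j)) \<xi> - 2 * t * m (Suc j) \<xi> + t\<^sup>2 * m j \<xi>)"
    have le: "\<phi> \<xi> * m j \<xi> \<le> ?q \<xi>" for \<xi>
    proof -
      have "\<phi> \<xi> * m j \<xi> \<le> (\<phi> \<xi>\<^sub>0 / 2 + C * ((norm \<xi>)\<^sup>2 - t)\<^sup>2) * m j \<xi>"
        by (rule mult_right_mono [OF bound]) (simp add: m_def)
      also have "\<dots> = ?q \<xi>"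
        by (simp add: m_def power2_eq_square algebra_simps)
      finally show ?thesis .
    qed
    have "0 \<le> (\<integral>\<xi>. \<phi> \<xi> * m j \<xi> \<partial>lborel)"
      unfolding m_def by (rule pos [OF w])
    also have "\<dots> \<le> (\<integral>\<xi>. ?q \<xi> \<partial>lborel)"
      using i1 int le by (intro integral_mono) auto
    also have "\<dots> = \<phi> \<xi>\<^sub>0 / 2 * M j + C * (M (Suc (Suc j)) - 2 * t * M (Suc j) + t\<^sup>2 * M j)"
      unfolding M_def using int by simp
    also have "\<dots> = M j * (\<phi> \<xi>\<^sub>0 / 2 + C * V k j)"
      unfolding M V_def by (simp add: algebra_simps)
    finally show ?thesis
      using Mp by (simp add: zero_le_mult_iff)
  qed
  \<comment> \<open>The mean (n/2 + j) / w should tend to t, so j is t w rounded down; both ratios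
    in V then tend to t and the deviation vanishes.\<close>
  define J where "J k = nat \<lfloor>t * real (Suc k)\<rfloor>" for k
  have t0: "t \<ge> 0" by (simp add: t_def)
  have "(\<lambda>k. C * V k (J k)) \<longlonglongrightarrow> C * (t * t - 2 * t * t + t\<^sup>2)"
  proof -
    have eq: "t + z / real (Suc k) = (t * real (Suc k) + z) / real (Suc k)" for z k
      by (simp add: add_divide_distrib del: of_nat_Suc)
    have lim: "(\<lambda>k. (?n / 2 + real (J k) + c) / real (Suc k)) \<longlonglongrightarrow> t" for c
    proof (rule tendsto_sandwich)
      show "\<forall>\<^sub>F k in sequentially. t + (?n / 2 + c - 1) / real (Suc k) \<le> (?n / 2 + real (J k) + c) / real (Suc k)"
      proof (rule always_eventually, rule allI)
        fix k
        have "t * real (Suc k) - 1 \<le> real (J k)"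
          unfolding J_def by linarith
        then show "t + (?n / 2 + c - 1) / real (Suc k) \<le> (?n / 2 + real (J k) + c) / real (Suc k)"
          unfolding eq by (intro divide_right_mono) auto
      qed
      show "\<forall>\<^sub>F k in sequentially. (?n / 2 + real (J k) + c) / real (Suc k) \<le> t + (?n / 2 + c) / real (Suc k)"
      proof (rule always_eventually, rule allI)
        fix k
        have "real (J k) \<le> t * real (Suc k)"
          using t0 unfolding J_def by (simp add: of_nat_nat)
        then show "(?n / 2 + real (J k) + c) / real (Suc k) \<le> t + (?n / 2 + c) / real (Suc k)"
          unfolding eq by (intro divide_right_mono) auto
      qed
      have z: "(\<lambda>k. x / real (Suc k)) \<longlonglongrightarrow> 0" for x
        by (rule LIMSEQ_Suc [OF lim_const_over_n])
      show "(\<lambda>k. t + (?n / 2 + c - 1) / real (Suc k)) \<longlonglongrightarrow> t"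
        using tendsto_add [OF tendsto_const z] by fastforce
      show "(\<lambda>k. t + (?n / 2 + c) / real (Suc k)) \<longlonglongrightarrow> t"
        using tendsto_add [OF tendsto_const z] by fastforce
    qed
    have "(\<lambda>k. a k (J k)) \<longlonglongrightarrow> t" "(\<lambda>k. a k (Suc (J k))) \<longlonglongrightarrow> t"
      using lim [of 0] lim [of 1] by (simp_all add: a_def add_ac)
    then show ?thesis
      unfolding V_def by (intro tendsto_intros)
  qed
  then have "- \<phi> \<xi>\<^sub>0 / 2 \<le> C * (t * t - 2 * t * t + t\<^sup>2)"
    by (rule LIMSEQ_le_const) (use V in auto)
  then show False
    using neg by (simp add: power2_eq_square)
qed

lemma cosine_transform_nonneg:
  fixes f :: "real \<Rightarrow> real"
  defines "F \<equiv> \<lambda>x::real^'n. f ((norm x)\<^sup>2)"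
  assumes f: "f \<in> borel_measurable borel" and F: "integrable lborel F"
    and a: "\<And>y j. y > 0 \<Longrightarrow> laguerre_coeff (real CARD('n) / 2 - 1) (\<lambda>x. f (x / y)) j \<ge> 0"
  shows "cosine_transform F \<xi> \<ge> 0"
proof (rule radial_nonneg_of_gaussian_moments [where \<phi> = "cosine_transform F" and B = "\<integral>x. \<bar>F x\<bar> \<partial>lborel"])
  show "continuous_on UNIV (cosine_transform F)"
    by (rule continuous_on_cosine_transform [OF F])
  show "\<bar>cosine_transform F \<xi>\<bar> \<le> (\<integral>x. \<bar>F x\<bar> \<partial>lborel)" for \<xi>
    by (rule abs_cosine_transform_le [OF F])
  show "cosine_transform F \<xi> = cosine_transform F \<eta>" if "norm \<xi> = norm \<eta>" for \<xi> \<eta>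
    by (rule cosine_transform_orthogonal [OF _ _ that])
      (use borel_measurable_integrable [OF F] in \<open>auto simp: F_def\<close>)
  fix j and w :: real assume w: "w > 0"
  let ?h = "\<lambda>\<xi>::real^'n. ((norm \<xi>)\<^sup>2) ^ j * exp (- (w * (norm \<xi>)\<^sup>2))"
  let ?n = "real CARD('n)"
  \<comment> \<open>The scale at which y |x|^2 is the argument |x|^2 / (4 w) of the Laguerre
    function in the transformed weight.\<close>
  define y where "y = 1 / (4 * w)"
  have y: "y > 0" using w by (simp add: y_def)
  let ?c = "sqrt pi ^ CARD('n) * fact j * w powr (- (?n / 2) - real j)"
  have h: "cosine_transform ?h x = ?c * (laguerre (?n / 2 - 1) j (y * (norm x)\<^sup>2) * exp (- (y * (norm x)\<^sup>2)))" for x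
    using gaussian_moment_fourier [OF w, of j x]
    by (simp add: cosine_transform_def inner_commute y_def mult_ac)
  have "(\<integral>\<xi>. cosine_transform F \<xi> * ?h \<xi> \<partial>lborel) = (\<integral>x. F x * cosine_transform ?h x \<partial>lborel)"
    by (rule integral_cosine_transform_mult [OF F integrable_gaussian_moment [OF w]])
  also have "\<dots> = (\<integral>x. ?c * (F x * (laguerre (?n / 2 - 1) j (y * (norm x)\<^sup>2) * exp (- (y * (norm x)\<^sup>2)))) \<partial>lborel)"
    unfolding h by (simp only: mult_ac)
  also have "\<dots> = ?c * (\<integral>x. F x * (laguerre (?n / 2 - 1) j (y * (norm x)\<^sup>2) * exp (- (y * (norm x)\<^sup>2))) \<partial>lborel)"
    by (rule integral_mult_right_zero)
  also have "\<dots> \<ge> 0"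
    using integral_laguerre_nonneg [where 'a = "real^'n", OF f _ y, of j] a [OF y, of j]
    by (intro mult_nonneg_nonneg) (auto simp: F_def)
  finally show "(\<integral>\<xi>. cosine_transform F \<xi> * ?h \<xi> \<partial>lborel) \<ge> 0" .
qed


section \<open>Fejer kernels and their masses on boxes\<close>

lemma cmod_sum_cis_squared:
  "(cmod (\<Sum>g\<in>A. cis (\<theta> g)))\<^sup>2 = (\<Sum>g\<in>A. \<Sum>h\<in>A. cos (\<theta> g - \<theta> h))"
  unfolding cmod_power2 by (simp add: power2_eq_square sum_product cos_diff sum.distrib)

text \<open>The kernel of period 1 in its manifestly nonnegative form. For N > 0 it expands with
  coefficients 1 - |d| / N at the frequencies |d| < N.\<close>

definition fejer :: "nat \<Rightarrow> real \<Rightarrow> real" where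
  "fejer N s = (cmod (\<Sum>k<N. cis (2 * pi * real k * s)))\<^sup>2 / real N"

lemma fejer_nonneg: "fejer N s \<ge> 0"
  by (simp add: fejer_def)

lemma continuous_on_fejer: "continuous_on S (fejer N)"
  unfolding fejer_def [abs_def] divide_inverse by (intro continuous_intros)

text \<open>Geometric summation: with z = \<open>cis (2 * pi * s)\<close>, |1 - z|^2 = 4 sin^2 (pi
  s) while |1 - z^N| \<le> 2. The product form stays meaningful at integers s, where the quotient
  would not.\<close>

lemma fejer_mult_sin_squared_le:
  assumes "N > 0"
  shows "fejer N s * (sin (pi * s))\<^sup>2 \<le> 1 / real N"
proof -
  let ?z = "cis (2 * pi * s)"
  have "cis (2 * pi * real k * s) = ?z ^ k" for k
    using Complex.DeMoivre [of "2 * pi * s" k] by (simp add: mult_ac)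
  then have D: "(\<Sum>k<N. cis (2 * pi * real k * s)) = (\<Sum>k<N. ?z ^ k)"
    by (simp only:)
  have tel: "(1 - ?z) * (\<Sum>k<N. ?z ^ k) = 1 - ?z ^ N"
    by (simp add: one_diff_power_eq [symmetric])
  have "(cmod (1 - ?z))\<^sup>2 = (1 - cos (2 * (pi * s)))\<^sup>2 + (sin (2 * (pi * s)))\<^sup>2"
    by (simp add: cmod_power2 mult_ac)
  also have "\<dots> = 2 - 2 * cos (2 * (pi * s))"
    using sin_cos_squared_add [of "2 * (pi * s)"] by (simp add: power2_eq_square algebra_simps)
  also have "\<dots> = 4 * (sin (pi * s))\<^sup>2"
    by (simp add: cos_double_sin)
  finally have sq: "(cmod (1 - ?z))\<^sup>2 = 4 * (sin (pi * s))\<^sup>2" .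
  have "cmod (1 - ?z ^ N) \<le> 2"
    using norm_triangle_ineq4 [of 1 "?z ^ N"] by (simp add: norm_power)
  then have "(cmod ((1 - ?z) * (\<Sum>k<N. ?z ^ k)))\<^sup>2 \<le> 2\<^sup>2"
    unfolding tel by (intro power_mono) auto
  then have "(sin (pi * s))\<^sup>2 * (cmod (\<Sum>k<N. ?z ^ k))\<^sup>2 \<le> 1"
    by (simp add: norm_mult power_mult_distrib sq)
  then show ?thesis
    using assms unfolding fejer_def D by (simp add: divide_right_mono mult.commute)
qed

lemma integral_cos_period:
  fixes k :: int and m :: nat
  shows "integral\<^sup>L lborel (\<lambda>s. cos (2 * pi * of_int k * s) * indicator {- (real m / 2)..real m / 2} s) =
    (if k = 0 then real m else 0)"
proof (cases "k = 0")
  case False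
  let ?F = "\<lambda>s. sin (2 * pi * of_int k * s) / (2 * pi * of_int k)"
  have "integral\<^sup>L lborel (\<lambda>s. cos (2 * pi * of_int k * s) * indicator {- (real m / 2)..real m / 2} s) =
      ?F (real m / 2) - ?F (- (real m / 2))"
  proof (rule integral_FTC_Icc_real)
    show "(?F has_real_derivative cos (2 * pi * of_int k * s)) (at s)" for s
      using False by (auto intro!: derivative_eq_intros)
  qed (auto intro!: continuous_intros)
  \<comment> \<open>The interval is m full periods; its ends are half-integers for odd m, but the
    sine only sees the integer multiple k m of pi.\<close>
  moreover have "sin (2 * pi * of_int k * (real m / 2)) = 0"
    using sin_npi_int [of "k * int m"] by (simp add: mult_ac)
  ultimately show ?thesis
    using False by simp
qed (simp add: measure_def)

lemma
  assumes N: "N > 0"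
  shows integrable_fejer_period: "integrable lborel (\<lambda>s. fejer N s * indicator {- (real m / 2)..real m / 2} s)"
    and integral_fejer_period:
      "integral\<^sup>L lborel (\<lambda>s. fejer N s * indicator {- (real m / 2)..real m / 2} s) = real m"
proof -
  let ?I = "indicator {- (real m / 2)..real m / 2} :: real \<Rightarrow> real"
  have int: "integrable lborel (\<lambda>s. g s * ?I s)" if "continuous_on UNIV g" for g :: "real \<Rightarrow> real"
    using borel_integrable_compact [of "{- (real m / 2)..real m / 2}" g] that
    by (auto simp: mult.commute intro: continuous_on_subset)
  show "integrable lborel (\<lambda>s. fejer N s * ?I s)"
    by (rule int [OF continuous_on_fejer])
  have ic: "integrable lborel (\<lambda>s. cos (2 * pi * of_int k * s) * ?I s)" for k :: int
    by (rule int) (intro continuous_intros)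
  have "fejer N s * ?I s = (\<Sum>k<N. \<Sum>l<N. cos (2 * pi * of_int (int k - int l) * s) * ?I s) / real N" for s
    unfolding fejer_def cmod_sum_cis_squared
    by (cases "s \<in> {- (real m / 2)..real m / 2}") (simp_all add: algebra_simps)
  then have "integral\<^sup>L lborel (\<lambda>s. fejer N s * ?I s) =
      (\<Sum>k<N. \<Sum>l<N. if int k - int l = 0 then real m else 0) / real N"
    using ic by (simp only: integral_divide_zero Bochner_Integration.integral_sum
        Bochner_Integration.integrable_sum integral_cos_period)
  also have "(\<Sum>k<N. \<Sum>l<N. if int k - int l = 0 then real m else 0) = real N * real m"
    by (simp add: sum.delta)
  finally show "integral\<^sup>L lborel (\<lambda>s. fejer N s * ?I s) = real m"
    using N by simp
qed

definition fejer_prod :: "nat \<Rightarrow> 'a::euclidean_space \<Rightarrow> real" where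
  "fejer_prod N x = (\<Prod>b\<in>Basis. fejer N (x \<bullet> b))"

lemma fejer_prod_nonneg: "fejer_prod N x \<ge> 0"
  unfolding fejer_prod_def by (intro prod_nonneg ballI fejer_nonneg)

text \<open>The coefficients of the product kernel are nonnegative, and its constant term is \<open>1\<close>.\<close>

lemma integral_le_integral_fejer_prod:
  fixes H :: "'a::euclidean_space \<Rightarrow> real"
  assumes H: "integrable lborel H" and pos: "\<And>\<xi>. cosine_transform H \<xi> \<ge> 0" and N: "N > 0"
  shows "integrable lborel (\<lambda>x. H x * fejer_prod N x)"
    and "(\<integral>x. H x \<partial>lborel) \<le> (\<integral>x. H x * fejer_prod N x \<partial>lborel)"
proof -
  let ?A = "PiE (Basis :: 'a set) (\<lambda>_. {..<N})"
  define \<theta> where "\<theta> g = (\<Sum>b\<in>Basis. (2 * pi * real (g b)) *\<^sub>R b)" for g :: "'a \<Rightarrow> nat"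
  have fin: "finite ?A" by (intro finite_PiE) auto
  have card: "real (card ?A) = real N ^ DIM('a)" by (simp add: card_PiE)
  have "(\<Prod>b\<in>Basis. \<Sum>k<N. cis (2 * pi * real k * (x \<bullet> b))) = (\<Sum>g\<in>?A. cis (\<theta> g \<bullet> x))" for x
    by (subst prod_sum_PiE) (auto simp: prod_cis \<theta>_def inner_sum_left inner_commute [of x])
  then have "fejer_prod N x = (cmod (\<Sum>g\<in>?A. cis (\<theta> g \<bullet> x)))\<^sup>2 / real N ^ DIM('a)" for x
    unfolding fejer_prod_def fejer_def
    by (simp add: prod_dividef prod_power_distrib [symmetric] prod_norm)
  then have *: "H x * fejer_prod N x =
      (\<Sum>g\<in>?A. \<Sum>h\<in>?A. H x * cos ((\<theta> g - \<theta> h) \<bullet> x)) / real N ^ DIM('a)" for x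
    by (simp add: cmod_sum_cis_squared sum_distrib_left inner_diff_left)
  show "integrable lborel (\<lambda>x. H x * fejer_prod N x)"
    unfolding * using integrable_mult_cos [OF H] by simp
  have val: "(\<integral>x. H x * fejer_prod N x \<partial>lborel) =
      (\<Sum>g\<in>?A. \<Sum>h\<in>?A. cosine_transform H (\<theta> g - \<theta> h)) / real N ^ DIM('a)"
    unfolding * cosine_transform_def using integrable_mult_cos [OF H]
    by (simp only: integral_divide_zero Bochner_Integration.integral_sum Bochner_Integration.integrable_sum)
  \<comment> \<open>For each g only the term h = g is kept; there are N ^ DIM('a) of them, which
    cancels the normalisation.\<close>
  have "(\<Sum>g\<in>?A. \<Sum>h\<in>?A. cosine_transform H (\<theta> g - \<theta> h)) \<ge> (\<Sum>g\<in>?A. cosine_transform H 0)"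
  proof (rule sum_mono)
    fix g assume g: "g \<in> ?A"
    have "cosine_transform H (\<theta> g - \<theta> g) \<le> (\<Sum>h\<in>?A. cosine_transform H (\<theta> g - \<theta> h))"
      by (rule member_le_sum [OF g]) (use pos fin in auto)
    then show "cosine_transform H 0 \<le> (\<Sum>h\<in>?A. cosine_transform H (\<theta> g - \<theta> h))"
      by simp
  qed
  then have "(\<Sum>g\<in>?A. cosine_transform H 0) / real N ^ DIM('a) \<le>
      (\<Sum>g\<in>?A. \<Sum>h\<in>?A. cosine_transform H (\<theta> g - \<theta> h)) / real N ^ DIM('a)"
    by (rule divide_right_mono) simp
  moreover have "(\<Sum>g\<in>?A. cosine_transform H 0) / real N ^ DIM('a) = (\<integral>x. H x \<partial>lborel)"
    using N by (simp add: card cosine_transform_def)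
  ultimately show "(\<integral>x. H x \<partial>lborel) \<le> (\<integral>x. H x * fejer_prod N x \<partial>lborel)"
    unfolding val by simp
qed

text \<open>The parameter m is the full side length, so m = 1 is the unit cell around the origin and
  m = 2 l the box with coordinates bounded by l. The product form lets integrals factor.\<close>

definition box_indicator :: "nat \<Rightarrow> 'a::euclidean_space \<Rightarrow> real" where
  "box_indicator m x = (\<Prod>b\<in>Basis. indicator {- (real m / 2)..real m / 2} (x \<bullet> b))"

lemma box_indicator_eq:
  "box_indicator m x = (if \<forall>b\<in>Basis. \<bar>x \<bullet> b\<bar> \<le> real m / 2 then 1 else 0)"
proof (cases "\<forall>b\<in>Basis. \<bar>x \<bullet> b\<bar> \<le> real m / 2")
  case True
  have iff: "t \<in> {- (real m / 2)..real m / 2} \<longleftrightarrow> \<bar>t\<bar> \<le> real m / 2" for t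
    by (simp only: atLeastAtMost_iff abs_le_iff) linarith
  then show ?thesis
    unfolding box_indicator_def indicator_def iff by (auto intro!: prod.neutral)
next
  case False
  then obtain b where "b \<in> Basis" "\<not> \<bar>x \<bullet> b\<bar> \<le> real m / 2" by auto
  then have "box_indicator m x = 0"
    unfolding box_indicator_def
    by (intro prod_zero) (auto simp: abs_le_iff indicator_def intro!: bexI [of _ b])
  then show ?thesis using False by simp
qed

text \<open>The kernel has mass 1 on each unit cell, so the cell around the origin contributes
  exactly 1.\<close>

lemma
  assumes N: "N > 0"
  shows integrable_fejer_box: "integrable lborel (\<lambda>x::'a::euclidean_space. fejer_prod N x * box_indicator m x)"
    and integral_fejer_box:
      "integral\<^sup>L lborel (\<lambda>x::'a. fejer_prod N x * box_indicator m x) = real m ^ DIM('a)"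
proof -
  let ?h = "\<lambda>s. fejer N s * indicator {- (real m / 2)..real m / 2} s"
  have eq: "fejer_prod N x * box_indicator m x = (\<Prod>b\<in>Basis. ?h (x \<bullet> b))" for x :: 'a
    by (simp add: fejer_prod_def box_indicator_def prod.distrib)
  show "integrable lborel (\<lambda>x::'a. fejer_prod N x * box_indicator m x)"
    unfolding eq by (rule integrable_lborel_prod) (rule integrable_fejer_period [OF N])
  show "integral\<^sup>L lborel (\<lambda>x::'a. fejer_prod N x * box_indicator m x) = real m ^ DIM('a)"
    unfolding eq
    by (subst integral_lborel_prod [OF integrable_fejer_period [OF N]]) (simp add: integral_fejer_period [OF N])
qed

text \<open>The sine vanishes at integers, so this measures the mass away from integral values of
  the coordinate along b. That coordinate contributes at most m / N, every other one m.\<close>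

lemma
  fixes b :: "'a::euclidean_space"
  assumes N: "N > 0" and b: "b \<in> Basis"
  shows integrable_fejer_box_sin:
      "integrable lborel (\<lambda>x. fejer_prod N x * box_indicator m x * (sin (pi * (x \<bullet> b)))\<^sup>2)"
    and integral_fejer_box_sin:
      "integral\<^sup>L lborel (\<lambda>x. fejer_prod N x * box_indicator m x * (sin (pi * (x \<bullet> b)))\<^sup>2) \<le>
        real m ^ DIM('a) / real N"
proof -
  let ?I = "indicator {- (real m / 2)..real m / 2} :: real \<Rightarrow> real"
  let ?h = "\<lambda>c s. fejer N s * ?I s * (if c = b then (sin (pi * s))\<^sup>2 else 1)"
  have "(\<Prod>c\<in>Basis. if c = b then (sin (pi * (x \<bullet> c)))\<^sup>2 else 1) = (sin (pi * (x \<bullet> b)))\<^sup>2" for x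
    using b by (subst prod.delta) auto
  then have eq: "fejer_prod N x * box_indicator m x * (sin (pi * (x \<bullet> b)))\<^sup>2 =
      (\<Prod>c\<in>Basis. ?h c (x \<bullet> c))" for x
    by (simp add: fejer_prod_def box_indicator_def prod.distrib)
  have int: "integrable lborel (?h c)" for c
  proof (rule Bochner_Integration.integrable_bound [OF integrable_fejer_period [OF N]])
    have [measurable]: "fejer N \<in> borel_measurable borel"
      by (rule borel_measurable_continuous_onI [OF continuous_on_fejer])
    show "?h c \<in> borel_measurable lborel" by measurable
    show "AE s in lborel. norm (?h c s) \<le> norm (fejer N s * ?I s)"
      using abs_sin_le_one by (auto simp: abs_mult fejer_nonneg abs_square_le_1 indicator_def intro!: mult_left_le)
  qed
  show "integrable lborel (\<lambda>x. fejer_prod N x * box_indicator m x * (sin (pi * (x \<bullet> b)))\<^sup>2)"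
    unfolding eq by (rule integrable_lborel_prod) (rule int)
  have one: "integral\<^sup>L lborel (?h b) \<le> real m / real N"
  proof -
    \<comment> \<open>The cosine with frequency 0 is the constant 1, written so that
      \<open>integral_cos_period\<close> gives the length of the interval.\<close>
    have "integral\<^sup>L lborel (?h b) \<le> integral\<^sup>L lborel (\<lambda>s. 1 / real N * (cos (2 * pi * of_int 0 * s) * ?I s))"
    proof (rule integral_mono [OF int])
      have "integrable lborel ?I"
        by (auto simp: integrable_indicator_iff)
      then show "integrable lborel (\<lambda>s. 1 / real N * (cos (2 * pi * of_int 0 * s) * ?I s))"
        by simp
      show "?h b s \<le> 1 / real N * (cos (2 * pi * of_int 0 * s) * ?I s)" for s
        using fejer_mult_sin_squared_le [OF N, of s] by (simp add: indicator_def)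
    qed
    also have "\<dots> = 1 / real N * real m"
      unfolding integral_mult_right_zero integral_cos_period by simp
    finally show ?thesis by simp
  qed
  have "integral\<^sup>L lborel (\<lambda>x. fejer_prod N x * box_indicator m x * (sin (pi * (x \<bullet> b)))\<^sup>2) =
      (\<Prod>c\<in>Basis. integral\<^sup>L lborel (?h c))"
    unfolding eq by (rule integral_lborel_prod [OF int])
  also have "\<dots> = integral\<^sup>L lborel (?h b) * (\<Prod>c\<in>Basis - {b}. integral\<^sup>L lborel (?h c))"
    using b by (simp add: prod.remove)
  also have "(\<Prod>c\<in>Basis - {b}. integral\<^sup>L lborel (?h c)) = (\<Prod>c\<in>Basis - {b}. real m)"
    by (rule prod.cong) (auto simp: integral_fejer_period [OF N])
  also have "\<dots> = real m ^ (DIM('a) - 1)"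
    using b by (simp add: card_Diff_singleton)
  also have "integral\<^sup>L lborel (?h b) * real m ^ (DIM('a) - 1) \<le> real m / real N * real m ^ (DIM('a) - 1)"
    using one by (rule mult_right_mono) simp
  also have "\<dots> = real m ^ DIM('a) / real N"
    using DIM_positive [where 'a = 'a] by (simp flip: power_Suc)
  finally show "integral\<^sup>L lborel (\<lambda>x. fejer_prod N x * box_indicator m x * (sin (pi * (x \<bullet> b)))\<^sup>2) \<le>
        real m ^ DIM('a) / real N" .
qed


section \<open>Majorising by terms of known Fejer mass\<close>

lemma sin_squared_diff_int:
  "(sin (pi * (s - of_int k)))\<^sup>2 = (sin (pi * s))\<^sup>2"
proof -
  have "sin (pi * (s - of_int k)) = sin (pi * s) * cos (pi * of_int k)"
    by (simp add: right_diff_distrib sin_diff)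
  moreover have "(cos (pi * of_int k))\<^sup>2 = 1"
    using sin_cos_squared_add [of "pi * of_int k"] by simp
  ultimately show ?thesis
    by (simp add: power_mult_distrib)
qed

lemma sin_squared_ge:
  assumes "0 < \<rho>" "\<rho> \<le> \<bar>u\<bar>" "\<bar>u\<bar> \<le> 1 / 2"
  shows "(sin (pi * \<rho>))\<^sup>2 \<le> (sin (pi * u))\<^sup>2"
proof -
  have \<rho>: "0 \<le> sin (pi * \<rho>)"
    using assms by (intro sin_ge_zero) auto
  have "sin (pi * \<rho>) \<le> sin (pi * \<bar>u\<bar>)"
    using assms by (intro sin_monotone_2pi_le) (auto intro: order_trans [of _ 0])
  then have "(sin (pi * \<rho>))\<^sup>2 \<le> (sin (pi * \<bar>u\<bar>))\<^sup>2"
    using \<rho> by (intro power_mono)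
  also have "\<dots> = (sin (pi * u))\<^sup>2"
    by (cases "u \<ge> 0") auto
  finally show ?thesis .
qed

text \<open>Inside the box of half-width l, a point near an integer point k satisfies H x < H k +
  \<eta>, and H k is positive at most for k = 0, which the unit cell accounts for. A point away from
  all integer points is covered by the sine penalty, and outside the box H is nonpositive.\<close>

lemma positive_part_bound:
  fixes H :: "'a::euclidean_space \<Rightarrow> real"
  assumes cont: "continuous_on UNIV H" and H0: "H 0 \<ge> 0"
    and far: "\<And>x. norm x \<ge> real l \<Longrightarrow> H x \<le> 0"
    and lat: "\<And>x. x \<noteq> 0 \<Longrightarrow> (\<forall>b\<in>Basis. x \<bullet> b \<in> \<int>) \<Longrightarrow> H x \<le> 0"
    and \<eta>: "\<eta> > 0"
  obtains C where "C \<ge> 0" "\<And>x. H x \<le> H 0 * box_indicator 1 x + \<eta> * box_indicator (2 * l) x +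
      C * (\<Sum>b\<in>Basis. box_indicator (2 * l) x * (sin (pi * (x \<bullet> b)))\<^sup>2)"
proof -
  \<comment> \<open>Large enough for the box, where |x| \<le> l n, and for the nearest integer
    points, at distance at most n/2 from it.\<close>
  let ?K = "cball 0 (real l * DIM('a) + DIM('a)) :: 'a set"
  have cK: "continuous_on ?K H" using cont by (rule continuous_on_subset) simp
  then have "uniformly_continuous_on ?K H" by (rule compact_uniformly_continuous) simp
  then obtain d where d: "d > 0" and
      uc: "\<And>x y. x \<in> ?K \<Longrightarrow> y \<in> ?K \<Longrightarrow> dist y x < d \<Longrightarrow> dist (H y) (H x) < \<eta>"
    unfolding uniformly_continuous_on_def using \<eta> by meson
  have "compact (H ` ?K)" using cK by (rule compact_continuous_image) simp
  then obtain B where B: "B > 0" "\<And>x. x \<in> ?K \<Longrightarrow> \<bar>H x\<bar> \<le> B"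
    using compact_imp_bounded [of "H ` ?K"] by (auto simp: bounded_pos)
  \<comment> \<open>If all coordinates are within \<rho> of integers, the distance to the nearest
    integer point is below \<rho> n \<le> d. The cap 1/2 keeps pi \<rho> in the range where the sine
    is positive and increasing.\<close>
  define \<rho> where "\<rho> = min (d / real DIM('a)) (1 / 2)"
  have \<rho>: "\<rho> > 0" "\<rho> \<le> 1 / 2" "\<rho> * real DIM('a) \<le> d"
    using d by (auto simp: \<rho>_def min_def field_simps)
  have sp: "sin (pi * \<rho>) > 0"
    using \<rho> by (intro sin_gt_zero) (auto intro: less_le_trans [of _ "pi / 1"])
  \<comment> \<open>One coordinate at distance at least \<rho> from the integers already makes the
    penalty at least B.\<close>
  define C where "C = B / (sin (pi * \<rho>))\<^sup>2"
  have C: "C \<ge> 0" using B by (simp add: C_def)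
  let ?E = "\<lambda>x. \<Sum>b\<in>Basis. box_indicator (2 * l) x * (sin (pi * (x \<bullet> b)))\<^sup>2"
  have box0: "box_indicator m (x :: 'a) \<ge> 0" for m x
    by (simp add: box_indicator_eq)
  have E0: "?E x \<ge> 0" for x :: 'a
    by (intro sum_nonneg mult_nonneg_nonneg box0) auto
  have "H x \<le> H 0 * box_indicator 1 x + \<eta> * box_indicator (2 * l) x + C * ?E x" for x
  proof (cases "\<forall>b\<in>Basis. \<bar>x \<bullet> b\<bar> \<le> real l")
    case False
    then obtain b where "b \<in> Basis" "real l < \<bar>x \<bullet> b\<bar>" by auto
    then have "H x \<le> 0"
      using Basis_le_norm [of b x] by (intro far) linarith
    moreover have "H 0 * box_indicator 1 x + \<eta> * box_indicator (2 * l) x + C * ?E x \<ge> 0"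
      using H0 \<eta> C by (intro add_nonneg_nonneg mult_nonneg_nonneg box0 E0) auto
    ultimately show ?thesis by linarith
  next
    case True
    then have bx: "box_indicator (2 * l) x = 1" by (simp add: box_indicator_eq)
    have l1: "norm y \<le> r * DIM('a)" if "\<And>b. b \<in> Basis \<Longrightarrow> \<bar>y \<bullet> b\<bar> \<le> r" for y :: 'a and r
    proof -
      have "norm y \<le> (\<Sum>b\<in>Basis. \<bar>y \<bullet> b\<bar>)" by (rule norm_le_l1)
      also have "\<dots> \<le> (\<Sum>b\<in>(Basis :: 'a set). r)" using that by (rule sum_mono)
      finally show ?thesis by (simp add: mult.commute)
    qed
    have xn: "norm x \<le> real l * DIM('a)"
      using True by (intro l1) auto
    then have xK: "x \<in> ?K" by simp
    define k where "k = (\<Sum>b\<in>Basis. of_int (round (x \<bullet> b)) *\<^sub>R b)"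
    have kb: "k \<bullet> b = of_int (round (x \<bullet> b))" if "b \<in> Basis" for b
      using that by (simp add: k_def inner_sum_left inner_Basis if_distrib cong: if_cong)
    have xk: "\<bar>(x - k) \<bullet> b\<bar> \<le> 1 / 2" if "b \<in> Basis" for b
      using of_int_round_abs_le [of "x \<bullet> b"] by (simp add: inner_diff_left kb [OF that] abs_minus_commute)
    show ?thesis
    proof (cases "\<forall>b\<in>Basis. \<bar>(x - k) \<bullet> b\<bar> < \<rho>")
      case near: True
      have "norm (x - k) < d"
      proof -
        have "norm (x - k) \<le> (\<Sum>b\<in>Basis. \<bar>(x - k) \<bullet> b\<bar>)" by (rule norm_le_l1)
        also have "\<dots> < (\<Sum>b\<in>(Basis :: 'a set). \<rho>)" using near by (intro sum_strict_mono) auto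
        also have "\<dots> \<le> d" using \<rho> by (simp add: mult.commute)
        finally show ?thesis .
      qed
      moreover have "k \<in> ?K"
      proof -
        have "norm (x - k) \<le> 1 / 2 * DIM('a)" using xk by (rule l1)
        moreover have "norm k \<le> norm x + norm (x - k)"
          using norm_triangle_ineq4 [of x "x - k"] by simp
        ultimately show ?thesis using xn by simp
      qed
      ultimately have Hk: "H x < H k + \<eta>"
        using uc [OF \<open>k \<in> ?K\<close> xK] by (simp add: dist_norm abs_less_iff)
      have "H k \<le> H 0 * box_indicator 1 x"
      proof (cases "k = 0")
        case True
        then have "box_indicator 1 x = 1" using xk by (simp add: box_indicator_eq)
        then show ?thesis using True by simp
      next
        case False
        then have "H k \<le> 0" by (rule lat) (simp add: kb)
        also have "0 \<le> H 0 * box_indicator 1 x" using H0 box0 by simp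
        finally show ?thesis .
      qed
      moreover have "C * ?E x \<ge> 0" using C E0 by simp
      ultimately show ?thesis using Hk bx by simp
    next
      case False
      then obtain b where b: "b \<in> Basis" "\<rho> \<le> \<bar>(x - k) \<bullet> b\<bar>" by auto
      have "(sin (pi * \<rho>))\<^sup>2 \<le> (sin (pi * ((x - k) \<bullet> b)))\<^sup>2"
        by (rule sin_squared_ge [OF \<rho>(1) b(2) xk [OF b(1)]])
      also have "\<dots> = (sin (pi * (x \<bullet> b)))\<^sup>2"
        unfolding inner_diff_left kb [OF b(1)] by (rule sin_squared_diff_int)
      also have "\<dots> \<le> ?E x"
        using member_le_sum [OF b(1), of "\<lambda>b. (sin (pi * (x \<bullet> b)))\<^sup>2"] bx by simp
      finally have "C * (sin (pi * \<rho>))\<^sup>2 \<le> C * ?E x"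
        using C by (rule mult_left_mono)
      moreover have "C * (sin (pi * \<rho>))\<^sup>2 = B" using sp by (simp add: C_def)
      moreover have "H x \<le> B" using B(2) [OF xK] by linarith
      moreover have "H 0 * box_indicator 1 x \<ge> 0" "\<eta> * box_indicator (2 * l) x \<ge> 0"
        using H0 \<eta> box0 by simp_all
      ultimately show ?thesis by linarith
    qed
  qed
  with C show thesis by (rule that)
qed

text \<open>The box is fixed by R alone and C depends on \<eta> but not on N. Hence N can go to
  infinity first, which removes the sine term, and \<eta> to 0 afterwards; what remains is H 0 times
  the mass 1 of the unit cell.\<close>

lemma integral_le_at_zero:
  fixes H :: "'a::euclidean_space \<Rightarrow> real"
  assumes H: "integrable lborel H" and pos: "\<And>\<xi>. cosine_transform H \<xi> \<ge> 0"
    and cont: "continuous_on UNIV H" and H0: "H 0 \<ge> 0"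
    and far: "\<And>x. norm x \<ge> R \<Longrightarrow> H x \<le> 0"
    and lat: "\<And>x. x \<noteq> 0 \<Longrightarrow> (\<forall>b\<in>Basis. x \<bullet> b \<in> \<int>) \<Longrightarrow> H x \<le> 0"
  shows "(\<integral>x. H x \<partial>lborel) \<le> H 0"
proof -
  obtain l :: nat where "R \<le> real l" using real_arch_simple by blast
  then have far': "H x \<le> 0" if "norm x \<ge> real l" for x using that by (intro far) simp
  let ?m = "2 * l" and ?n = "DIM('a)"
  have "(\<integral>x. H x \<partial>lborel) \<le> H 0 + \<eta> * real ?m ^ ?n" if \<eta>: "\<eta> > 0" for \<eta>
  proof -
    obtain C where C: "C \<ge> 0" and bd: "\<And>x. H x \<le> H 0 * box_indicator 1 x + \<eta> * box_indicator ?m x +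
        C * (\<Sum>b\<in>Basis. box_indicator ?m x * (sin (pi * (x \<bullet> b)))\<^sup>2)"
      using positive_part_bound [OF cont H0 far' lat \<eta>] by blast
    have N: "(\<integral>x. H x \<partial>lborel) \<le> H 0 + \<eta> * real ?m ^ ?n + C * real ?n * real ?m ^ ?n / real (Suc k)" for k
    proof -
      let ?N = "Suc k"
      let ?s = "\<lambda>b x::'a. fejer_prod ?N x * box_indicator ?m x * (sin (pi * (x \<bullet> b)))\<^sup>2"
      let ?r = "\<lambda>x. H 0 * (fejer_prod ?N x * box_indicator 1 x) + \<eta> * (fejer_prod ?N x * box_indicator ?m x) +
        C * (\<Sum>b\<in>Basis. ?s b x)"
      have i: "integrable lborel (\<lambda>x::'a. fejer_prod ?N x * box_indicator m x)" for m
        by (rule integrable_fejer_box) simp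
      have int_s: "integrable lborel (?s b)" if "b \<in> Basis" for b
        by (rule integrable_fejer_box_sin) (use that in auto)
      have "(\<integral>x. H x \<partial>lborel) \<le> (\<integral>x. H x * fejer_prod ?N x \<partial>lborel)"
        by (rule integral_le_integral_fejer_prod(2) [OF H pos]) simp
      also have "\<dots> \<le> (\<integral>x. ?r x \<partial>lborel)"
      proof (rule integral_mono)
        show "integrable lborel (\<lambda>x. H x * fejer_prod ?N x)"
          by (rule integral_le_integral_fejer_prod(1) [OF H pos]) simp
        show "integrable lborel ?r"
          by (intro Bochner_Integration.integrable_add integrable_mult_right
              Bochner_Integration.integrable_sum i int_s)
        fix x
        have "H x * fejer_prod ?N x \<le> (H 0 * box_indicator 1 x + \<eta> * box_indicator ?m x +
            C * (\<Sum>b\<in>Basis. box_indicator ?m x * (sin (pi * (x \<bullet> b)))\<^sup>2)) * fejer_prod ?N x"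
          by (rule mult_right_mono [OF bd fejer_prod_nonneg])
        also have "\<dots> = ?r x"
          by (simp add: distrib_left distrib_right sum_distrib_left sum_distrib_right mult_ac)
        finally show "H x * fejer_prod ?N x \<le> ?r x" .
      qed
      also have "\<dots> = H 0 * real 1 ^ ?n + \<eta> * real ?m ^ ?n + C * (\<Sum>b\<in>Basis. integral\<^sup>L lborel (?s b))"
      proof -
        have "integrable lborel (\<lambda>x. \<Sum>b\<in>Basis. ?s b x)"
          by (intro Bochner_Integration.integrable_sum int_s)
        moreover have "(\<integral>x. (\<Sum>b\<in>Basis. ?s b x) \<partial>lborel) = (\<Sum>b\<in>Basis. integral\<^sup>L lborel (?s b))"
          by (rule Bochner_Integration.integral_sum [OF int_s])
        ultimately show ?thesis
          using i integral_fejer_box [where 'a = 'a, of ?N]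
          by (simp only: Bochner_Integration.integral_add integral_mult_right_zero
              Bochner_Integration.integrable_add integrable_mult_right zero_less_Suc simp_thms)
      qed
      also have "\<dots> \<le> H 0 * real 1 ^ ?n + \<eta> * real ?m ^ ?n + C * (\<Sum>b\<in>(Basis :: 'a set). real ?m ^ ?n / real ?N)"
        by (intro add_left_mono mult_left_mono sum_mono integral_fejer_box_sin C) auto
      finally show ?thesis by simp
    qed
    have "(\<lambda>k. H 0 + \<eta> * real ?m ^ ?n + C * real ?n * real ?m ^ ?n / real (Suc k)) \<longlonglongrightarrow>
        H 0 + \<eta> * real ?m ^ ?n + 0"
      by (intro tendsto_add tendsto_const LIMSEQ_Suc [OF lim_const_over_n])
    then show ?thesis
      using LIMSEQ_le_const N by fastforce
  qed
  note main = this
  have "((\<lambda>\<eta>. H 0 + \<eta> * real ?m ^ ?n) \<longlongrightarrow> H 0 + 0 * real ?m ^ ?n) (at_right 0)"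
    by (intro tendsto_intros)
  moreover have "\<forall>\<^sub>F \<eta> in at_right 0. (\<integral>x. H x \<partial>lborel) \<le> H 0 + \<eta> * real ?m ^ ?n"
    using main by (auto simp: eventually_at_right_field intro!: exI [of _ 1])
  ultimately show ?thesis
    using tendsto_lowerbound [of _ "H 0" "at_right 0"] by fastforce
qed


section \<open>Lattice coordinates and integrability\<close>

lemma
  fixes S :: "'a::euclidean_space \<Rightarrow> 'a" and \<phi> :: "'a \<Rightarrow> real"
  assumes S: "lborel = density (distr lborel borel S) (\<lambda>_. ennreal v)" and v: "v \<ge> 0"
    and [measurable]: "S \<in> borel_measurable borel" "\<phi> \<in> borel_measurable borel"
  shows integrable_substitution: "integrable lborel \<phi> \<longleftrightarrow> integrable lborel (\<lambda>x. v * \<phi> (S x))"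
    and integral_substitution: "(\<integral>x. \<phi> x \<partial>lborel) = v * (\<integral>x. \<phi> (S x) \<partial>lborel)"
proof -
  have "integrable lborel \<phi> \<longleftrightarrow> integrable (density (distr lborel borel S) (\<lambda>_. ennreal v)) \<phi>"
    by (simp only: S [symmetric])
  also have "\<dots> \<longleftrightarrow> integrable lborel (\<lambda>x. v * \<phi> (S x))"
    using v by (subst integrable_density) (auto simp: integrable_distr_eq simp del: integrable_mult_left_iff)
  finally show "integrable lborel \<phi> \<longleftrightarrow> integrable lborel (\<lambda>x. v * \<phi> (S x))" .
  have "(\<integral>x. \<phi> x \<partial>lborel) = (\<integral>x. \<phi> x \<partial>density (distr lborel borel S) (\<lambda>_. ennreal v))"
    by (simp only: S [symmetric])
  also have "\<dots> = (\<integral>x. v * \<phi> (S x) \<partial>lborel)"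
    using v by (subst integral_density) (auto simp: integral_distr)
  finally show "(\<integral>x. \<phi> x \<partial>lborel) = v * (\<integral>x. \<phi> (S x) \<partial>lborel)"
    by simp
qed

text \<open>The Jacobian is found without a determinant: T pulls the fundamental parallelotope back
  to the half-open unit cube, of measure 1, so the scaling constant is the volume of the
  parallelotope.\<close>

lemma lattice_basis_substitution:
  fixes b :: "'n::finite \<Rightarrow> real^'n"
  assumes b: "lattice_basis b \<Lambda>"
  defines "T \<equiv> \<lambda>s::real^'n. \<Sum>i\<in>UNIV. (s $ i) *\<^sub>R b i"
  shows "covolume \<Lambda> > 0"
    and "lborel = density (distr lborel borel T) (\<lambda>_. ennreal (covolume \<Lambda>))"
proof -
  let ?P = "fundamental_parallelotope b"
  obtain M where M: "\<And>x. (\<Sum>i\<in>UNIV. (M *v x) $ i *\<^sub>R b i) = x"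
    "\<And>t i. (M *v (\<Sum>j\<in>UNIV. t j *\<^sub>R b j)) $ i = t i"
    using lattice_basis_coordinates [OF b] by blast
  have lin: "linear T"
    unfolding T_def by (intro linearI) (simp_all add: scaleR_left_distrib sum.distrib scaleR_sum_right)
  have contT: "continuous_on UNIV T"
    unfolding T_def by (intro continuous_intros)
  then have [measurable]: "T \<in> borel_measurable borel"
    by (rule borel_measurable_continuous_onI)
  have TM: "T (M *v x) = x" for x
    by (simp add: T_def M(1))
  have P [measurable]: "?P \<in> sets borel"
    by (rule fundamental_parallelotope_borel [OF b])
  have cube: "T -` ?P = {s. \<forall>i. 0 \<le> s $ i \<and> s $ i < 1}"
  proof (rule set_eqI)
    fix s :: "real^'n"
    have "M *v T s = s" using M(2) [of "\<lambda>i. s $ i"] by (simp add: T_def vec_eq_iff)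
    then show "s \<in> T -` ?P \<longleftrightarrow> s \<in> {s. \<forall>i. 0 \<le> s $ i \<and> s $ i < 1}"
      unfolding fundamental_parallelotope_def T_def
      using M(2) by (auto intro!: exI [of _ "\<lambda>i. s $ i"])
  qed
  have one: "emeasure lborel (T -` ?P) = 1"
  proof (rule antisym)
    have m: "T -` ?P \<in> sets borel"
      using measurable_sets [of T borel borel ?P] by simp
    let ?u = "(\<chi> i. 1) :: real^'n"
    have prod1: "(\<Prod>b\<in>Basis. ?u \<bullet> b) = 1"
      by (rule prod.neutral) (auto simp: Basis_vec_def inner_axis)
    have le: "0 \<bullet> b \<le> ?u \<bullet> b" if "b \<in> Basis" for b :: "real^'n"
      using that by (auto simp: Basis_vec_def inner_axis)
    have "T -` ?P \<subseteq> cbox 0 ?u" unfolding cube by (auto simp: mem_box_cart less_imp_le)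
    then have "emeasure lborel (T -` ?P) \<le> emeasure lborel (cbox 0 ?u)"
      by (rule emeasure_mono) simp
    also have "\<dots> = 1" using le prod1 by (subst emeasure_lborel_cbox) auto
    finally show "emeasure lborel (T -` ?P) \<le> 1" .
    have "box 0 ?u \<subseteq> T -` ?P" unfolding cube by (auto simp: mem_box_cart less_imp_le)
    then have "emeasure lborel (box 0 ?u) \<le> emeasure lborel (T -` ?P)"
      by (rule emeasure_mono) (use m in simp)
    moreover have "emeasure lborel (box 0 ?u) = 1"
      using le prod1 by (subst emeasure_lborel_box) auto
    ultimately show "1 \<le> emeasure lborel (T -` ?P)" by simp
  qed
  have ratio: "emeasure lborel (T -` A) * emeasure lborel ?P = emeasure lborel A" if A: "A \<in> sets borel" for A
  proof -
    have ind: "indicator S (T x) = indicator (T -` S) x" for S x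
      by (simp add: indicator_def)
    have m: "T -` S \<in> sets borel" if "S \<in> sets borel" for S
      using measurable_sets [of T borel borel S] that by simp
    have "(\<integral>\<^sup>+x. indicator A (T x) \<partial>lborel) * (\<integral>\<^sup>+y. indicator ?P y \<partial>lborel) =
        (\<integral>\<^sup>+x. indicator ?P (T x) \<partial>lborel) * (\<integral>\<^sup>+y. indicator A y \<partial>lborel)"
      by (rule nn_integral_linear_ratio [OF lin TM]) (use A P in \<open>auto intro!: borel_measurable_indicator\<close>)
    then show ?thesis
      using m [OF A] m [OF P] A P one by (simp add: ind)
  qed
  \<comment> \<open>The ball and its preimage, a nonempty open set, both have nonzero volume, and
    that of the ball is finite; by \<open>ratio\<close> the volume of the parallelotope is then
    neither 0 nor infinite.\<close>
  let ?B = "ball 0 1 :: (real^'n) set"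
  have B: "emeasure lborel ?B \<noteq> 0" "emeasure lborel ?B \<noteq> \<top>"
    using unit_ball_vol_pos [of "real CARD('n)"]
    by (auto simp: emeasure_ball simp del: unit_ball_vol_pos)
  have "open (T -` ?B)"
    using contT by (intro open_vimage) auto
  moreover have "0 \<in> T -` ?B" by (simp add: T_def)
  ultimately have "emeasure lborel (T -` ?B) \<noteq> 0"
    using open_not_negligible [of "T -` ?B"]
    by (metis borel_open emptyE negligible_iff_null_sets null_setsI null_sets_completionI sets_lborel)
  then have fin: "emeasure lborel ?P \<noteq> 0" "emeasure lborel ?P \<noteq> \<top>"
    using ratio [of ?B] B by (auto simp: ennreal_mult_eq_top_iff)
  have V: "emeasure lborel ?P = ennreal (covolume \<Lambda>)"
    using fin(2) P by (simp add: covolume_eq [OF b] measure_def emeasure_completion ennreal_enn2real_if)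
  with fin show "covolume \<Lambda> > 0"
    by (metis ennreal_eq_0_iff linorder_not_le)
  show "lborel = density (distr lborel borel T) (\<lambda>_. ennreal (covolume \<Lambda>))"
  proof (rule measure_eqI)
    fix A :: "(real^'n) set" assume "A \<in> sets lborel"
    then have A: "A \<in> sets borel" by simp
    have "emeasure (density (distr lborel borel T) (\<lambda>_. ennreal (covolume \<Lambda>))) A =
        ennreal (covolume \<Lambda>) * emeasure lborel (T -` A)"
      using A by (simp add: emeasure_density nn_integral_cmult_indicator emeasure_distr)
    then show "emeasure lborel A = emeasure (density (distr lborel borel T) (\<lambda>_. ennreal (covolume \<Lambda>))) A"
      using ratio [OF A] by (simp add: V mult.commute)
  qed simp
qed

text \<open>For \<alpha> \<ge> 0 the factor u powr \<alpha> is at most (1 + u) powr \<alpha>,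
  leaving the integrable majorant (1 + u) powr (- 1 - \<epsilon>). In the application \<alpha> \<ge>
  0 comes from n > 1.\<close>

lemma set_integrable_powr_decay:
  fixes f :: "real \<Rightarrow> real"
  assumes [measurable]: "f \<in> borel_measurable borel" and \<alpha>: "\<alpha> \<ge> 0" and \<epsilon>: "\<epsilon> > 0"
    and bd: "\<And>x. x \<ge> 0 \<Longrightarrow> \<bar>f x\<bar> \<le> C * (1 + \<bar>x\<bar>) powr (- \<alpha> - 1 - \<epsilon>)"
  shows "set_integrable lborel {0..} (\<lambda>u. f u * u powr \<alpha>)"
proof -
  let ?g = "\<lambda>u::real. (1 + u) powr (- 1 - \<epsilon>)"
  have C: "C \<ge> 0" using bd [of 0] by (simp add: abs_le_iff)
  have "(\<integral>\<^sup>+u. ennreal (?g u) * indicator {0..} u \<partial>lborel) = ennreal (0 - (- ((1 + 0) powr (- \<epsilon>) / \<epsilon>)))"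
  proof (rule nn_integral_FTC_atLeast)
    show "((\<lambda>u. - ((1 + u) powr (- \<epsilon>) / \<epsilon>)) has_real_derivative ?g u) (at u)" if "0 \<le> u" for u
      using that \<epsilon> by (auto intro!: derivative_eq_intros simp: powr_diff powr_minus divide_simps)
    show "((\<lambda>u. - ((1 + u) powr (- \<epsilon>) / \<epsilon>)) \<longlongrightarrow> 0) at_top"
      using \<epsilon> by real_asymp
  qed auto
  then have "integrable lborel (\<lambda>u. ?g u * indicator {0..} u)"
    by (intro integrableI_nonneg) (auto simp: ennreal_mult' ennreal_indicator)
  then have "integrable lborel (\<lambda>u. C * (?g u * indicator {0..} u))"
    by (rule integrable_mult_right)
  then show ?thesis
    unfolding set_integrable_def
  proof (rule Bochner_Integration.integrable_bound)
    show "AE u in lborel. norm (indicator {0..} u *\<^sub>R (f u * u powr \<alpha>)) \<le> norm (C * (?g u * indicator {0..} u))"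
    proof (rule AE_I2)
      fix u :: real
      show "norm (indicator {0..} u *\<^sub>R (f u * u powr \<alpha>)) \<le> norm (C * (?g u * indicator {0..} u))"
      proof (cases "u \<ge> 0")
        case True
        have "\<bar>f u\<bar> * u powr \<alpha> \<le> C * (1 + u) powr (- \<alpha> - 1 - \<epsilon>) * (1 + u) powr \<alpha>"
          using bd [OF True] True \<alpha> C by (intro mult_mono powr_mono2) auto
        also have "\<dots> = C * ((1 + u) powr (- \<alpha> - 1 - \<epsilon>) * (1 + u) powr \<alpha>)"
          by simp
        also have "(1 + u) powr (- \<alpha> - 1 - \<epsilon>) * (1 + u) powr \<alpha> = ?g u"
          by (simp flip: powr_add)
        finally show ?thesis
          using True C by (simp add: abs_mult)
      qed simp
    qed
  qed simp
qed

section \<open>The bound for a lattice packing\<close>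

theorem theorem2p5:
  fixes f :: "real \<Rightarrow> real" and \<Lambda> :: "(real^'n) set"
  assumes "CARD('n) > 1"
    and "SILP (real CARD('n) / 2 - 1) f"
    and "f 0 = 1"
    and "\<And>x. x \<ge> 1 \<Longrightarrow> f x \<le> 0"
    and "full_rank_lattice \<Lambda>"
  shows "ereal (center_density \<Lambda>) \<le>
    ereal (Gamma (real CARD('n) / 2)) /
    ereal (2 ^ CARD('n) * pi powr (real CARD('n) / 2) *
      (LINT x:{0..}|lborel. f x * x powr (real CARD('n) / 2 - 1)))"
proof -
  define n where "n = CARD('n)"
  define \<alpha> where "\<alpha> = real n / 2 - 1"
  define I where "I = (LINT x:{0..}|lborel. f x * x powr \<alpha>)"
  have \<alpha>0: "\<alpha> \<ge> 0"
    using assms(1) by (simp add: \<alpha>_def n_def)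
  \<comment> \<open>Only the values of \<open>f\<close> on \<open>[0, \<infinity>)\<close> are constrained, so \<open>f\<close> itself need not be measurable.\<close>
  define g where "g = (\<lambda>x. f (max 0 x))"
  have gf: "g x = f x" if "x \<ge> 0" for x
    using that by (simp add: g_def)
  obtain \<epsilon> C where \<epsilon>: "\<epsilon> > 0" and C: "\<And>x. x \<ge> 0 \<Longrightarrow> \<bar>f x\<bar> \<le> C * (1 + \<bar>x\<bar>) powr (- \<alpha> - 1 - \<epsilon>)"
    and cf: "continuous_on {0..} f"
    and coeff: "\<And>y j. y > 0 \<Longrightarrow> laguerre_coeff \<alpha> (\<lambda>x. f (x / y)) j \<ge> 0"
    using assms(2) unfolding SILP_def \<alpha>_def n_def by blast
  have contg: "continuous_on UNIV g"
    unfolding g_def by (intro continuous_on_compose2 [OF cf] continuous_intros) auto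
  then have gm [measurable]: "g \<in> borel_measurable borel"
    by (rule borel_measurable_continuous_onI)
  have coeffg: "laguerre_coeff \<alpha> (\<lambda>x. g (x / y)) j \<ge> 0" if y: "y > 0" for y j
  proof -
    have "laguerre_coeff \<alpha> (\<lambda>x. g (x / y)) j = laguerre_coeff \<alpha> (\<lambda>x. f (x / y)) j"
      unfolding laguerre_coeff_def
      by (intro arg_cong2 [where f = "(/)"] refl set_lebesgue_integral_cong) (use y gf in auto)
    then show ?thesis using coeff [OF y] by simp
  qed
  have Ig: "(LINT u:{0..}|lborel. g u * u powr \<alpha>) = I"
    unfolding I_def by (rule set_lebesgue_integral_cong) (use gf in auto)
  define F where "F = (\<lambda>x::real^'n. g ((norm x)\<^sup>2))"
  have Fm [measurable]: "F \<in> borel_measurable borel"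
    unfolding F_def by measurable
  have intF: "integrable lborel F"
    unfolding F_def
    using set_integrable_powr_decay [OF gm \<alpha>0 \<epsilon>, of C] C gf integrable_radial [OF gm, where 'a = "real^'n"]
    by (simp add: \<alpha>_def n_def)
  have F_eq: "(\<integral>x. F x \<partial>lborel) = pi powr (n / 2) / Gamma (n / 2) * I"
    unfolding F_def Ig [symmetric] using integral_radial [OF gm, where 'a = "real^'n"]
    by (simp add: \<alpha>_def n_def)
  have posF: "cosine_transform F \<xi> \<ge> 0" for \<xi>
    unfolding F_def
    by (rule cosine_transform_nonneg [OF gm]) (use intF coeffg in \<open>auto simp: F_def \<alpha>_def n_def\<close>)
  have Gp: "Gamma (real n / 2) > 0"
    by (simp add: n_def)
  \<comment> \<open>The transform at 0 is the integral of F, so the denominator of the bound cannot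
    be negative.\<close>
  have "(\<integral>x. F x \<partial>lborel) \<ge> 0"
    using posF [of 0] by (simp add: cosine_transform_def)
  then have I0: "I \<ge> 0"
    unfolding F_eq using Gp by (simp add: zero_le_mult_iff zero_le_divide_iff)
  obtain b where b: "lattice_basis b \<Lambda>"
    using assms(5) by (auto simp: full_rank_lattice_def)
  have L: "\<Lambda> = {\<Sum>i\<in>UNIV. of_int (c i) *\<^sub>R b i |c. True}" and ind: "independent (range b)"
    using b by (auto simp: lattice_basis_def)
  obtain M where M: "\<And>x. (\<Sum>i\<in>UNIV. (M *v x) $ i *\<^sub>R b i) = x"
    "\<And>t i. (M *v (\<Sum>j\<in>UNIV. t j *\<^sub>R b j)) $ i = t i"
    using lattice_basis_coordinates [OF b] by blast
  define T where "T s = (\<Sum>i\<in>UNIV. (s $ i) *\<^sub>R b i)" for s :: "real^'n"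
  define V where "V = covolume \<Lambda>"
  have V: "V > 0" and TV: "lborel = density (distr lborel borel T) (\<lambda>_. ennreal V)"
    using lattice_basis_substitution [OF b] by (simp_all add: V_def T_def [abs_def])
  have MT: "M *v T s = s" for s
    using M(2) [of "\<lambda>i. s $ i"] by (simp add: T_def vec_eq_iff)
  have contT: "continuous_on UNIV T"
    unfolding T_def by (intro continuous_intros)
  then have [measurable]: "T \<in> borel_measurable borel"
    by (rule borel_measurable_continuous_onI)
  define m where "m = min_length \<Lambda>"
  have bdd: "bdd_below (norm ` (\<Lambda> - {0}))"
    by (rule bdd_belowI [of _ 0]) auto
  have mle: "m \<le> norm v" if "v \<in> \<Lambda>" "v \<noteq> 0" for v
    unfolding m_def min_length_def using that by (intro cINF_lower [OF bdd]) auto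
  have m0: "m \<ge> 0"
  proof -
    fix i :: 'n
    \<comment> \<open>A basis vector makes the set under the infimum nonempty; on the empty set
      \<open>INF\<close> would be an unspecified value.\<close>
    have "b i \<noteq> 0" using ind dependent_zero by (metis rangeI)
    moreover have "b i \<in> \<Lambda>"
      unfolding L by (intro CollectI exI [of _ "\<lambda>j. if j = i then 1 else 0"])
        (simp add: if_distrib [of real_of_int] if_distrib [of "\<lambda>c. c *\<^sub>R _"] cong: if_cong)
    ultimately have "\<Lambda> - {0} \<noteq> {}" by blast
    then show ?thesis
      unfolding m_def min_length_def by (rule cINF_greatest) simp
  qed
  \<comment> \<open>The bound with denominators cleared: the center density is m^n / (2^n V), and
    \<open>F_eq\<close> expresses the integral of F by I.\<close>
  have main: "m ^ n * (\<integral>x. F x \<partial>lborel) \<le> V"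
  proof (cases "m = 0")
    \<comment> \<open>Here the left side vanishes, which spares a proof that the minimal length is
      positive.\<close>
    case True
    then show ?thesis using V by (simp add: n_def power_0_left)
  next
    case False
    with m0 have m: "m > 0" by simp
    \<comment> \<open>In these coordinates integer vectors s are lattice vectors T s, and dividing
      by m puts the nonzero ones at norm at least 1, where f is nonpositive.\<close>
    define H where "H s = F ((1 / m) *\<^sub>R T s)" for s
    have sub: "(\<integral>x. \<phi> x \<partial>lborel) = (1 / m) ^ n * V * (\<integral>s. \<phi> ((1 / m) *\<^sub>R T s) \<partial>lborel)"
      and sub_int: "integrable lborel \<phi> \<Longrightarrow> integrable lborel (\<lambda>s. \<phi> ((1 / m) *\<^sub>R T s))"
      if [measurable]: "\<phi> \<in> borel_measurable borel" for \<phi> :: "real^'n \<Rightarrow> real"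
    proof -
      have sc: "(lborel :: (real^'n) measure) = density (distr lborel borel (\<lambda>x. (1 / m) *\<^sub>R x)) (\<lambda>_. ennreal ((1 / m) ^ n))"
        using lborel_affine [of "1 / m" "0 :: real^'n"] m by (simp add: n_def ennreal_power)
      show "(\<integral>x. \<phi> x \<partial>lborel) = (1 / m) ^ n * V * (\<integral>s. \<phi> ((1 / m) *\<^sub>R T s) \<partial>lborel)"
        using m V by (subst integral_substitution [OF sc], simp, simp, simp, subst integral_substitution [OF TV]) auto
      assume "integrable lborel \<phi>"
      then have "integrable lborel (\<lambda>x. (1 / m) ^ n * \<phi> ((1 / m) *\<^sub>R x))"
        using m by (subst (asm) integrable_substitution [OF sc]) auto
      then have "integrable lborel (\<lambda>x. \<phi> ((1 / m) *\<^sub>R x))"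
        using m by simp
      then have "integrable lborel (\<lambda>x. V * \<phi> ((1 / m) *\<^sub>R T x))"
        using V by (subst (asm) integrable_substitution [OF TV]) auto
      then show "integrable lborel (\<lambda>s. \<phi> ((1 / m) *\<^sub>R T s))"
        using V by simp
    qed
    have intH: "integrable lborel H"
      unfolding H_def by (rule sub_int [OF Fm intF])
    \<comment> \<open>A bound for the inverse of T, so that large s forces T s outside the ball of
      radius m.\<close>
    obtain K where K: "K > 0" "\<And>x. norm (M *v x) \<le> norm x * K"
      using bounded_linear.pos_bounded [OF matrix_vector_mul_bounded_linear [of M]] by blast
    have "(\<integral>s. H s \<partial>lborel) \<le> H 0"
    proof (rule integral_le_at_zero [OF intH, where R = "m * K"])
      show "cosine_transform H \<eta> \<ge> 0" for \<eta>
      proof -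
        \<comment> \<open>The frequency with the same phase after the substitution: the transpose of
          M compensates T, and the factor m compensates 1 / m.\<close>
        define \<zeta> where "\<zeta> = m *\<^sub>R (\<eta> v* M)"
        have "\<zeta> \<bullet> ((1 / m) *\<^sub>R T s) = \<eta> \<bullet> s" for s
          using m by (simp add: \<zeta>_def dot_lmul_matrix MT)
        then have "cosine_transform F \<zeta> = (1 / m) ^ n * V * cosine_transform H \<eta>"
          unfolding cosine_transform_def H_def
          by (subst sub) auto
        then show ?thesis
          using posF [of \<zeta>] mult_pos_neg [of "(1 / m) ^ n * V" "cosine_transform H \<eta>"] m V
          by (intro leI notI) simp
      qed
      show "continuous_on UNIV H"
        unfolding H_def F_def
        by (intro continuous_on_compose2 [OF contg] continuous_intros contT) auto
      show "H 0 \<ge> 0"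
        by (simp add: H_def F_def T_def g_def assms(3))
      have far: "H s \<le> 0" if "m \<le> norm (T s)" for s
      proof -
        have "1 \<le> (norm (T s) / m)\<^sup>2" using that m by (intro one_le_power) simp
        then show ?thesis
          using m assms(4) [of "(norm (T s) / m)\<^sup>2"] by (simp add: H_def F_def g_def max_def)
      qed
      show "H s \<le> 0" if "m * K \<le> norm s" for s
      proof (rule far)
        have "m * K \<le> norm (T s) * K"
          using that K(2) [of "T s"] by (simp add: MT)
        then show "m \<le> norm (T s)" using K(1) by simp
      qed
      show "H s \<le> 0" if s: "s \<noteq> 0" "\<forall>b\<in>Basis. s \<bullet> b \<in> \<int>" for s
      proof (rule far, rule mle)
        have "s $ i \<in> \<int>" for i
          using s(2) by (auto simp: Basis_vec_def inner_axis)
        then have "s $ i = of_int \<lfloor>s $ i\<rfloor>" for i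
          by (metis Ints_cases floor_of_int)
        then show "T s \<in> \<Lambda>"
          unfolding L T_def by (intro CollectI exI [of _ "\<lambda>i. \<lfloor>s $ i\<rfloor>"]) simp
        show "T s \<noteq> 0"
          using s(1) MT [of s] by auto
      qed
    qed
    also have "H 0 = 1"
      by (simp add: H_def F_def T_def g_def assms(3))
    finally have "(1 / m) ^ n * V * (\<integral>s. H s \<partial>lborel) \<le> (1 / m) ^ n * V * 1"
      using m V by (intro mult_left_mono) auto
    moreover have "(\<integral>x. F x \<partial>lborel) = (1 / m) ^ n * V * (\<integral>s. H s \<partial>lborel)"
      unfolding H_def by (rule sub [OF Fm])
    ultimately show ?thesis
      using m by (simp add: power_divide field_simps)
  qed
  show ?thesis
  proof (cases "I = 0")
    \<comment> \<open>In \<open>ereal\<close> a positive number divided by 0 is \<infinity>, in line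
      with the convention for a vanishing integral.\<close>
    case True
    then show ?thesis
      using less_imp_neq [OF Gp, symmetric] by (simp add: I_def \<alpha>_def n_def)
  next
    case False
    with I0 have I: "I > 0" by simp
    have p: "pi powr (real n / 2) > 0" by simp
    have "m ^ n * (pi powr (n / 2) * I) \<le> V * Gamma (n / 2)"
      using main Gp unfolding F_eq by (simp add: field_simps)
    then have "center_density \<Lambda> \<le> Gamma (n / 2) / (2 ^ n * pi powr (n / 2) * I)"
      using V I p unfolding center_density_def m_def [symmetric] V_def [symmetric] n_def [symmetric]
      by (simp add: power_divide divide_simps mult_ac)
    then show ?thesis
      using I p by (simp add: I_def \<alpha>_def n_def)
  qed
qed

end
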